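(* Let $F$ be a field with $\operatorname{char}(F)\neq 2$. If $\circledast$ is an involution of the first kind on the algebra $UT_2(F)$ of $2\times 2$ upper triangular matrices over $F$, then $C(UT_2(F),\circledast)$ is finitely generated as a $T( * )$-space; that is, there exists a finite set $W\subseteq F\langle X\cup X^*\rangle$ such that $C(UT_2(F),\circledast)=\langle W\rangle^{TS( * )}$.
   Context: All algebras are unitary and associative over $F$. An involution on an algebra $A$ is a map $\circledast:A\to A$ with $(a+b)^\circledast=a^\circledast+b^\circledast$, $(ab)^\circledast=b^\circledast a^\circledast$ and $(a^\circledast)^\circledast=a$ for all $a,b\in A$; it is of the first kind if $a^\circledast=a$ for every $a$ in the center $Z(A)$ (so it is then $F$-linear). Let $X=\{x_1,x_2,\ldots\}$ and $X^*=\{x_1^*,x_2^*,\ldots\}$ be disjoint infinite sets, and let $F\langle X\cup X^*\rangle$ be the free unitary associative $F$-algebra freely generated by $X\cup X^*$, with the $F$-linear involution $*$ determined by $x_i\mapsto x_i^*$, $x_i^*\mapsto x_i$. A $*$-endomorphism is a (unital) algebra endomorphism $\varphi$ of $F\langle X\cup X^*\rangle$ with $\varphi(f^* )=\varphi(f)^*$ for all $f$. A $T( * )$-space is a vector subspace of $F\langle X\cup X^*\rangle$ closed under all $*$-endomorphisms. For $W\subseteq F\langle X\cup X^*\rangle$, $\langle W\rangle^{TS( * )}$ is the intersection of all $T( * )$-spaces containing $W$. For an algebra with involution $(A,\circledast)$, $C(A,\circledast)$ is the set of all $*$-central polynomials: those $f(x_1,x_1^*,\ldots,x_n,x_n^*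 )\in F\langle X\cup X^*\rangle$ such that $f(a_1,a_1^\circledast,\ldots,a_n,a_n^\circledast)\in Z(A)$ for all $a_1,\ldots,a_n\in A$. It is a $T( * )$-space. *)

theory Defs
  imports "HOL-Analysis.Analysis" "HOL-Library.Poly_Mapping"
begin

locale assoc_algebra = vector_space scale
  for scale :: "'a::field \<Rightarrow> 'b::ring_1 \<Rightarrow> 'b" +
  assumes scale_mult_left: "scale c x * y = scale c (x * y)"
    and scale_mult_right: "x * scale c y = scale c (x * y)"

definition alg_center :: "'b::ring_1 set"
  where "alg_center = {z. \<forall>a. z * a = a * z}"

definition involution :: "('b::ring_1 \<Rightarrow> 'b) \<Rightarrow> bool"
  where "involution s \<longleftrightarrow>
    (\<forall>a b. s (a + b) = s a + s b) \<and> (\<forall>a b. s (a * b) = s b * s a) \<and> (\<forall>a. s (s a) = a)"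

definition first_kind :: "('b::ring_1 \<Rightarrow> 'b) \<Rightarrow> bool"
  where "first_kind s \<longleftrightarrow> (\<forall>a\<in>alg_center. s a = a)"


datatype letter = Var nat | SVar nat

text \<open>Words form the free monoid on the letters. It is written additively (\<open>0\<close> is the empty word
  and \<open>+\<close> is concatenation), so that the convolution product that \<^theory>\<open>HOL-Library.Poly_Mapping\<close>
  provides on finitely supported functions is the product of the monoid algebra, which is here the
  free unitary associative algebra.\<close>

datatype free_word = FWord (letters: "letter list")

instantiation free_word :: monoid_add
begin

definition zero_free_word :: free_word
  where "0 = FWord []"

definition plus_free_word :: "free_word \<Rightarrow> free_word \<Rightarrow> free_word"
  where "u + v = FWord (letters u @ letters v)"

instance
  by standard (simp_all add: zero_free_word_def plus_free_word_def)

end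

type_synonym 'a free_alg = "free_word \<Rightarrow>\<^sub>0 'a"

definition fscale :: "'a::field \<Rightarrow> 'a free_alg \<Rightarrow> 'a free_alg"
  where "fscale c f = Poly_Mapping.single 0 c * f"

definition gen :: "letter \<Rightarrow> 'a::field free_alg"
  where "gen l = Poly_Mapping.single (FWord [l]) 1"

fun letter_star :: "letter \<Rightarrow> letter"
  where
    "letter_star (Var i) = SVar i"
  | "letter_star (SVar i) = Var i"

definition word_star :: "free_word \<Rightarrow> free_word"
  where "word_star w = FWord (rev (map letter_star (letters w)))"

text \<open>The coefficient of \<open>w\<close> in \<open>fstar f\<close> is the coefficient of \<open>word_star w\<close> in \<open>f\<close>; as
  \<open>word_star\<close> is an involutive bijection, this sends each monomial \<open>w\<close> to \<open>word_star w\<close>.\<close>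

definition fstar :: "'a::field free_alg \<Rightarrow> 'a free_alg"
  where "fstar f = Poly_Mapping.map_key word_star f"

definition star_endomorphism :: "('a::field free_alg \<Rightarrow> 'a free_alg) \<Rightarrow> bool"
  where "star_endomorphism \<phi> \<longleftrightarrow>
    Vector_Spaces.linear fscale fscale \<phi> \<and> (\<forall>f g. \<phi> (f * g) = \<phi> f * \<phi> g) \<and> \<phi> 1 = 1 \<and>
    (\<forall>f. \<phi> (fstar f) = fstar (\<phi> f))"

definition T_star_space :: "'a::field free_alg set \<Rightarrow> bool"
  where "T_star_space S \<longleftrightarrow>
    module.subspace fscale S \<and> (\<forall>\<phi>. star_endomorphism \<phi> \<longrightarrow> \<phi> ` S \<subseteq> S)"

definition TS_star :: "'a::field free_alg set \<Rightarrow> 'a free_alg set"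
  where "TS_star W = \<Inter>{S. T_star_space S \<and> W \<subseteq> S}"

text \<open>In an algebra with scalar multiplication \<open>smul\<close> and involution \<open>s\<close>, \<open>eval_star smul s a f\<close>
  is the value of \<open>f\<close> under \<open>x\<^sub>i \<mapsto> a i\<close> and \<open>x\<^sub>i\<^sup>* \<mapsto> s (a i)\<close>. All variables are assigned a value at
  once; only the finitely many that occur in \<open>f\<close> matter.\<close>

fun letter_val :: "('b \<Rightarrow> 'b) \<Rightarrow> (nat \<Rightarrow> 'b) \<Rightarrow> letter \<Rightarrow> 'b"
  where
    "letter_val s a (Var i) = a i"
  | "letter_val s a (SVar i) = s (a i)"

definition eval_star ::
    "('a::field \<Rightarrow> 'b::ring_1 \<Rightarrow> 'b) \<Rightarrow> ('b \<Rightarrow> 'b) \<Rightarrow> (nat \<Rightarrow> 'b) \<Rightarrow> 'a free_alg \<Rightarrow> 'b"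
  where "eval_star smul s a f =
    (\<Sum>w\<in>Poly_Mapping.keys f.
      smul (Poly_Mapping.lookup f w) (prod_list (map (letter_val s a) (letters w))))"

definition star_central_polys ::
    "('a::field \<Rightarrow> 'b::ring_1 \<Rightarrow> 'b) \<Rightarrow> ('b \<Rightarrow> 'b) \<Rightarrow> 'a free_alg set"
  where "star_central_polys smul s = {f. \<forall>a. eval_star smul s a f \<in> alg_center}"


typedef (overloaded) 'a ut2 = "{A :: 'a::field^2^2. A $ 2 $ 1 = 0}"
  morphisms mat_of_ut2 ut2_of_mat
  by (rule exI[of _ 0]) simp

setup_lifting type_definition_ut2

instantiation ut2 :: (field) ring_1
begin

lift_definition zero_ut2 :: "'a ut2" is 0
  by simp

lift_definition one_ut2 :: "'a ut2" is "mat 1"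
  by (simp add: mat_def)

lift_definition plus_ut2 :: "'a ut2 \<Rightarrow> 'a ut2 \<Rightarrow> 'a ut2" is "(+)"
  by simp

lift_definition minus_ut2 :: "'a ut2 \<Rightarrow> 'a ut2 \<Rightarrow> 'a ut2" is "(-)"
  by simp

lift_definition uminus_ut2 :: "'a ut2 \<Rightarrow> 'a ut2" is uminus
  by simp

lift_definition times_ut2 :: "'a ut2 \<Rightarrow> 'a ut2 \<Rightarrow> 'a ut2" is "(**)"
  by (simp add: matrix_matrix_mult_def sum_2)

instance
proof
  fix a b c :: "'a ut2"
  show "a * b * c = a * (b * c)"
    by transfer (simp add: matrix_mul_assoc)
  show "(a + b) * c = a * c + b * c"
    by transfer (vector matrix_matrix_mult_def sum.distrib[symmetric] field_simps)
  show "a * (b + c) = a * b + a * c"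
    by transfer (simp add: matrix_add_ldistrib)
  show "(0 :: 'a ut2) \<noteq> 1"
    by transfer (simp add: mat_def vec_eq_iff)
qed (transfer; simp add: algebra_simps)+

end

lift_definition ut2_scale :: "'a::field \<Rightarrow> 'a ut2 \<Rightarrow> 'a ut2" is "\<lambda>c A. \<chi> i j. c * A $ i $ j"
  by simp

lemma assoc_algebra_ut2: "assoc_algebra (ut2_scale :: 'a::field \<Rightarrow> 'a ut2 \<Rightarrow> 'a ut2)"
  by standard (transfer; simp add: vec_eq_iff matrix_matrix_mult_def sum_distrib_left algebra_simps)+

lemma poly_mapping_induct [case_names single sum]:
  fixes f :: "'k \<Rightarrow>\<^sub>0 'c::monoid_add"
  assumes single: "\<And>k v. P (Poly_Mapping.single k v)"
    and sum: "\<And>f g. P f \<Longrightarrow> P g \<Longrightarrow> P (f + g)"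
  shows "P f"
proof (induction f rule: Poly_Mapping.update_induct)
  case const
  show ?case using single[of undefined 0] by simp
next
  case (update f k v)
  then have "Poly_Mapping.update k v f = f + Poly_Mapping.single k v"
    by (intro poly_mapping_eqI)
      (auto simp: lookup_update lookup_add lookup_single when_def not_in_keys_iff_lookup_eq_zero)
  then show ?case using update sum single by simp
qed

lemma assoc_algebra_free_alg: "assoc_algebra (fscale :: 'a::field \<Rightarrow> 'a free_alg \<Rightarrow> 'a free_alg)"
proof -
  have commute: "Poly_Mapping.single 0 c * f = f * Poly_Mapping.single 0 c"
    for c :: 'a and f :: "'a free_alg"
  proof (induction f rule: poly_mapping_induct)
    case (single w d)
    show ?case by (simp add: mult_single mult.commute)
  qed (simp add: algebra_simps)
  show ?thesis
  proof
    fix a b :: 'a and x y :: "'a free_alg"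
    show "fscale a (x + y) = fscale a x + fscale a y"
      by (simp add: fscale_def algebra_simps)
    show "fscale (a + b) x = fscale a x + fscale b x"
      by (simp add: fscale_def algebra_simps single_add)
    show "fscale a (fscale b x) = fscale (a * b) x"
      by (simp add: fscale_def mult_single flip: mult.assoc)
    show "fscale 1 x = x"
      by (simp add: fscale_def)
    show "fscale a x * y = fscale a (x * y)"
      by (simp add: fscale_def mult.assoc)
    show "x * fscale a y = fscale a (x * y)"
      by (metis fscale_def commute mult.assoc)
  qed
qed

lemma letter_star_involutive [simp]: "letter_star (letter_star l) = l"
  by (cases l) simp_all

lemma word_star_involutive [simp]: "word_star (word_star w) = w"
  by (simp add: word_star_def rev_map comp_def)

lemma inj_word_star: "inj word_star"
  by (metis injI word_star_involutive)

lemma word_star_plus: "word_star (u + v) = word_star v + word_star u"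
  by (simp add: word_star_def plus_free_word_def)

lemma fstar_single: "fstar (Poly_Mapping.single w c) = Poly_Mapping.single (word_star w) c"
  unfolding fstar_def by (metis inj_word_star map_key_single word_star_involutive)

lemma fstar_add: "fstar (f + g) = fstar f + fstar g"
  unfolding fstar_def by (rule map_key_plus[OF inj_word_star])

lemma fstar_mult: "fstar (f * g) = fstar g * fstar f"
proof (induction f rule: poly_mapping_induct)
  case (single u c)
  show ?case
  proof (induction g rule: poly_mapping_induct)
    case (single v d)
    show ?case by (simp add: mult_single fstar_single word_star_plus mult.commute)
  qed (simp add: algebra_simps fstar_add)
qed (simp add: algebra_simps fstar_add)

lemma involution_fstar: "involution fstar"
proof -
  have "fstar (fstar f) = f" for f :: "'a free_alg"
    by (induction f rule: poly_mapping_induct) (simp_all add: fstar_single fstar_add)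
  then show ?thesis
    by (simp add: involution_def fstar_add fstar_mult)
qed

lemma fstar_scale: "fstar (fscale c f) = fscale c (fstar f)"
  by (induction f rule: poly_mapping_induct)
    (simp_all add: fscale_def mult_single fstar_single fstar_add distrib_left)

lemma fstar_gen: "fstar (gen (Var i)) = gen (SVar i)" "fstar (gen (SVar i)) = gen (Var i)"
  by (simp_all add: gen_def fstar_single word_star_def)

end

theory Submission
  imports Defs "HOL-Computational_Algebra.Polynomial"
begin

text \<open>As \<open>2\<close> is invertible, the free algebra is spanned by words in the symmetric elements
  \<open>y\<^sub>i = x\<^sub>i + x\<^sub>i\<^sup>*\<close> and the skew elements \<open>z\<^sub>i = x\<^sub>i - x\<^sub>i\<^sup>*\<close>. In suitable coordinates an
  involution of the first kind exchanges the two diagonal entries and multiplies the upper right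
  entry by \<open>\<epsilon> = \<plusminus>1\<close>. If \<open>\<epsilon> = -1\<close>, the \<open>y\<^sub>i\<close> take scalar values \<open>a\<^sub>i\<close> and the \<open>z\<^sub>i\<close> the values
  \<open>t\<^sub>i (e\<^sub>1\<^sub>1 - e\<^sub>2\<^sub>2) + c\<^sub>i e\<^sub>1\<^sub>2\<close>; if \<open>\<epsilon> = 1\<close>, the values are \<open>a\<^sub>i + c\<^sub>i e\<^sub>1\<^sub>2\<close> and
  \<open>t\<^sub>i (e\<^sub>1\<^sub>1 - e\<^sub>2\<^sub>2)\<close>. Modulo finitely many identities, words may be reordered at the cost of terms with a
  single commutator; comparing the diagonal entries and then the coefficients of the \<open>c\<^sub>i\<close>
  leaves only polynomials that vanish as functions, which are accounted for by \<open>t\<^sup>q = t\<close>.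
  An identity \<open>r\<close> generates a two-sided ideal inside the T-space of \<open>u r v\<close>, for fresh variables \<open>u, v\<close>.

  If \<open>\<epsilon> = -1\<close>, a central \<open>f\<close> is half the sum of \<open>f + f\<^sup>*\<close>, an instance of \<open>x + x\<^sup>*\<close>, and of the
  identity \<open>f - f\<^sup>*\<close>. If \<open>\<epsilon> = 1\<close>, the central polynomials that are not identities come from
  \<open>(y z + z y) z'\<close> (even positive degree in the \<open>z\<^sub>i\<close>) and from \<open>y\<^sup>p\<close>, or \<open>y\<^sup>q\<close> over a field with
  \<open>q\<close> elements (degree zero in the \<open>z\<^sub>i\<close>).\<close>

section \<open>Polynomials that vanish as functions\<close>

text \<open>An exponent \<open>q\<close> with \<open>t ^ q = t\<close> for all \<open>t\<close>. The
  value 1 over an infinite field makes this relation trivial, so finite and infinite fields share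
  the same statements.\<close>

definition field_exp :: "'a::field itself \<Rightarrow> nat"
  where "field_exp _ = (if finite (UNIV :: 'a set) then CARD('a) else 1)"

text \<open>Over a finite field, multiplication by \<open>t \<noteq> 0\<close> permutes the nonzero
  elements; their nonzero product therefore equals itself times \<open>t ^ (q - 1)\<close>.\<close>

lemma power_field_exp: "(t::'a::field) ^ field_exp TYPE('a) = t"
proof (cases "finite (UNIV :: 'a set) \<and> t \<noteq> 0")
  case False
  then show ?thesis
    by (auto simp: field_exp_def zero_power card_gt_0_iff)
next
  case True
  let ?X = "UNIV - {0::'a}"
  have fin: "finite ?X"
    using True by (meson finite_Diff)
  have "bij_betw ((*) t) ?X ?X"
    by (rule bij_betwI[where g = "\<lambda>x. x / t"]) (use True in auto)
  then have "(\<Prod>x\<in>?X. t * x) = \<Prod>?X"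
    by (rule prod.reindex_bij_betw)
  then have "t ^ card ?X * \<Prod>?X = \<Prod>?X"
    by (simp add: prod.distrib)
  moreover have "\<Prod>?X \<noteq> 0"
    using fin by simp
  ultimately have "t ^ card ?X = 1"
    by simp
  moreover have "CARD('a) = Suc (card ?X)"
    using True card_Suc_Diff1[of "UNIV::'a set" 0] by simp
  ultimately have "t ^ CARD('a) = t"
    by (simp only: power_Suc mult_1_right)
  with True show ?thesis
    by (simp add: field_exp_def)
qed

lemma field_exp_pos: "field_exp TYPE('a::field) > 0"
  by (auto simp: field_exp_def card_gt_0_iff)

text \<open>An even exponent would give \<open>-1 = (-1) ^ q = 1\<close>.\<close>

lemma odd_field_exp:
  assumes "(2::'a::field) \<noteq> 0"
  shows "odd (field_exp TYPE('a))"
proof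
  assume "even (field_exp TYPE('a))"
  then have "(-1::'a) ^ field_exp TYPE('a) = 1"
    by simp
  then have "1 + 1 = (0::'a)"
    unfolding power_field_exp by (metis add.right_inverse)
  then show False
    using assms by simp
qed

text \<open>Adding 1 permutes the ring, so the sum of all elements stays the same although it grows
  by the number of elements.\<close>

lemma of_nat_CARD:
  assumes "finite (UNIV :: 'a::ring_1 set)"
  shows "of_nat CARD('a) = (0::'a)"
proof -
  have "(\<Sum>x\<in>UNIV. x) = (\<Sum>x\<in>UNIV. x + 1 :: 'a)"
    by (rule sum.reindex_bij_witness[where i = "\<lambda>x. x + 1" and j = "\<lambda>x. x - 1"]) auto
  then show ?thesis
    by (simp add: sum.distrib)
qed

text \<open>Every field element is a root of \<open>P\<close>. A nonzero polynomial has at most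
  \<open>degree P\<close> roots, which contradicts either the infinitude of the field or the bound
  on the exponents.\<close>

lemma vanishing_power_sum:
  fixes c :: "nat \<Rightarrow> 'a::field"
  assumes "finite E" "finite (UNIV :: 'a set) \<Longrightarrow> E \<subseteq> {..<field_exp TYPE('a)}"
    and zero: "\<And>t. (\<Sum>e\<in>E. c e * t ^ e) = 0"
    and "e \<in> E"
  shows "c e = 0"
proof -
  define P where "P = (\<Sum>e\<in>E. monom (c e) e)"
  have coeff: "coeff P n = (if n \<in> E then c n else 0)" for n
    using \<open>finite E\<close> by (simp add: P_def coeff_sum)
  have roots: "{t. poly P t = 0} = UNIV"
    using zero by (simp add: P_def poly_sum poly_monom)
  have "P = 0"
  proof (rule ccontr)
    assume "P \<noteq> 0"
    then have fin: "finite (UNIV :: 'a set)" and le: "CARD('a) \<le> degree P"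
      using poly_roots_finite[of P] card_poly_roots_bound[of P] roots by auto
    have "degree P \<in> E"
      using \<open>P \<noteq> 0\<close> coeff by (metis leading_coeff_0_iff)
    then show False
      using fin le assms(2) by (auto simp: field_exp_def)
  qed
  then show ?thesis
    using coeff[of e] \<open>e \<in> E\<close> by simp
qed

lemma prod_mset_remove_var:
  fixes v :: "'i \<Rightarrow> 'a::comm_monoid_mult"
  shows "(\<Prod>i\<in>#M. (v(x := t)) i) = (\<Prod>i\<in>#filter_mset (\<lambda>i. i \<noteq> x) M. v i) * t ^ count M x"
  by (induction M) (auto simp: mult_ac)

text \<open>A polynomial over a finite field of order \<open>q\<close> that vanishes as a function lies in the ideal
  generated by the \<open>t\<^sub>i\<^sup>q - t\<^sub>i\<close>; hence so does its image under a linear map on monomials, modulo any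
  subspace that contains the images of these relations. Over an infinite field the relations
  are trivial, as \<^const>\<open>field_exp\<close> is then \<open>1\<close>.\<close>

lemma (in vector_space) vanishing_monomial_image:
  fixes m :: "'k \<Rightarrow> 'i multiset"
  assumes U: "subspace U" and "finite I"
    and rel: "\<And>M x. L (M + replicate_mset (field_exp TYPE('a)) x) - L (add_mset x M) \<in> U"
    and zero: "\<And>v. (\<Sum>k\<in>I. c k * (\<Prod>i\<in>#m k. v i)) = 0"
  shows "(\<Sum>k\<in>I. scale (c k) (L (m k))) \<in> U"
proof -
  let ?q = "field_exp TYPE('a)"
  define X where "X = (\<Union>k\<in>I. set_mset (m k))"
  have "finite X" "\<forall>k\<in>I. set_mset (m k) \<subseteq> X"
    using \<open>finite I\<close> by (auto simp: X_def)
  then show ?thesis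
    using \<open>finite I\<close> rel zero
  proof (induction X arbitrary: I m L rule: finite_induct)
    case empty
    \<comment> \<open>No variables are left, so every product is 1 at any assignment, here
      \<open>undefined\<close>, and the sum collapses to a multiple of \<open>L {#}\<close> with
      vanishing coefficient.\<close>
    then have "(\<Sum>k\<in>I. scale (c k) (L (m k))) = scale (\<Sum>k\<in>I. c k * (\<Prod>i\<in>#m k. undefined i)) (L {#})"
      by (simp flip: scale_sum_left)
    then show ?case
      using empty.prems(4) U by (simp add: subspace_0)
  next
    case (insert x X)
    \<comment> \<open>Over a finite field, exponents of \<open>x\<close> are lowered by
      \<open>q - 1\<close> at a time until they are below \<open>q\<close>. This changes neither the
      power function nor the value of \<open>L\<close> modulo \<open>U\<close>.\<close>
    have ex: "\<exists>n'. (finite (UNIV::'a set) \<longrightarrow> n' < ?q) \<and> (\<forall>t::'a. t ^ n = t ^ n') \<and>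
        (\<forall>N. L (N + replicate_mset n x) - L (N + replicate_mset n' x) \<in> U)" for n
    proof (induction n rule: less_induct)
      case (less n)
      show ?case
      proof (cases "finite (UNIV::'a set) \<and> n \<ge> ?q")
        case False
        then show ?thesis
          using subspace_0[OF U] by (intro exI[of _ n]) auto
      next
        case True
        then obtain d where n: "n = ?q + d"
          using le_Suc_ex by blast
        have "?q > 1"
          using True card_mono[of "UNIV::'a set" "{0,1}"] by (simp add: field_exp_def)
        then obtain n' where n': "finite (UNIV::'a set) \<longrightarrow> n' < ?q" "\<forall>t::'a. t ^ Suc d = t ^ n'"
          "\<forall>N. L (N + replicate_mset (Suc d) x) - L (N + replicate_mset n' x) \<in> U"
          using less[of "Suc d"] n by auto
        have "L (N + replicate_mset n x) - L (N + replicate_mset n' x) \<in> U" for N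
        proof -
          have "N + replicate_mset d x + replicate_mset ?q x = N + replicate_mset n x"
            "add_mset x (N + replicate_mset d x) = N + replicate_mset (Suc d) x"
            by (simp_all add: n multiset_eq_iff)
          then have "L (N + replicate_mset n x) - L (N + replicate_mset (Suc d) x) \<in> U"
            using insert.prems(3)[of "N + replicate_mset d x" x] by (simp only:)
          from subspace_add[OF U this n'(3)[rule_format, of N]] show ?thesis
            by (simp only: add_diff_eq diff_add_cancel)
        qed
        moreover have "t ^ n = t ^ n'" for t :: 'a
          using n'(2) by (simp add: n power_add power_field_exp)
        ultimately show ?thesis
          using n' by blast
      qed
    qed
    obtain red where red: "\<And>n. finite (UNIV::'a set) \<Longrightarrow> red n < ?q"
      "\<And>n (t::'a). t ^ n = t ^ red n"
      "\<And>n N. L (N + replicate_mset n x) - L (N + replicate_mset (red n) x) \<in> U"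
      using ex by metis
    define N where "N k = filter_mset (\<lambda>i. i \<noteq> x) (m k)" for k
    define d where "d k = red (count (m k) x)" for k
    define E where "E = d ` I"
    have "finite E"
      using insert.prems by (simp add: E_def)
    have m: "m k = N k + replicate_mset (count (m k) x) x" for k
      by (rule multiset_eqI) (auto simp: N_def)
    have group: "(\<Sum>k\<in>I. h k) = (\<Sum>e\<in>E. \<Sum>k\<in>{k \<in> I. d k = e}. h k)" for h :: "'k \<Rightarrow> 'c::comm_monoid_add"
      unfolding E_def by (rule sum.image_gen) (rule insert.prems)
    \<comment> \<open>For a fixed reduced exponent \<open>e\<close> of \<open>x\<close>, the other
      variables are treated by the induction hypothesis for the map \<open>L\<close> shifted by
      \<open>e\<close> copies of \<open>x\<close>.\<close>
    have part: "(\<Sum>k\<in>{k \<in> I. d k = e}. scale (c k) (L (N k + replicate_mset e x))) \<in> U" if "e \<in> E" for e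
    proof (rule insert.IH[where L = "\<lambda>M. L (M + replicate_mset e x)" and m = N])
      show "\<forall>k\<in>{k \<in> I. d k = e}. set_mset (N k) \<subseteq> X"
        using insert.prems(1) by (auto simp: N_def)
      show "finite {k \<in> I. d k = e}"
        using insert.prems by simp
      show "L (M + replicate_mset ?q y + replicate_mset e x) - L (add_mset y M + replicate_mset e x) \<in> U" for M y
        using insert.prems(3)[of "M + replicate_mset e x" y] by (simp add: add_ac)
      fix v :: "'i \<Rightarrow> 'a"
      \<comment> \<open>With the other variables frozen this is a polynomial in the value
        \<open>t\<close> of \<open>x\<close>, with exponents below \<open>q\<close> if the field is
        finite; so each coefficient is zero.\<close>
      have "(\<Sum>e\<in>E. (\<Sum>k\<in>{k \<in> I. d k = e}. c k * (\<Prod>i\<in>#N k. v i)) * t ^ e) = 0" for t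
      proof -
        have "(\<Sum>k\<in>I. c k * (\<Prod>i\<in>#m k. (v(x := t)) i)) = (\<Sum>k\<in>I. c k * (\<Prod>i\<in>#N k. v i) * t ^ d k)"
          by (simp only: prod_mset_remove_var N_def d_def mult.assoc flip: red(2))
        then show ?thesis
          using insert.prems(4)[of "v(x := t)"] by (simp add: group sum_distrib_right)
      qed
      then show "(\<Sum>k\<in>{k \<in> I. d k = e}. c k * (\<Prod>i\<in>#N k. v i)) = 0"
        by (rule vanishing_power_sum[OF \<open>finite E\<close>, rotated]) (use that red(1) in \<open>auto simp: E_def d_def\<close>)
    qed
    have "(\<Sum>k\<in>I. scale (c k) (L (N k + replicate_mset (d k) x)))
        = (\<Sum>e\<in>E. \<Sum>k\<in>{k \<in> I. d k = e}. scale (c k) (L (N k + replicate_mset e x)))"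
      unfolding group by (intro sum.cong refl) auto
    also have "\<dots> \<in> U"
      by (rule subspace_sum[OF U]) (rule part)
    finally have "(\<Sum>k\<in>I. scale (c k) (L (N k + replicate_mset (d k) x))) \<in> U" .
    moreover have "(\<Sum>k\<in>I. scale (c k) (L (m k) - L (N k + replicate_mset (d k) x))) \<in> U"
    proof (intro subspace_sum[OF U] subspace_scale[OF U])
      show "L (m k) - L (N k + replicate_mset (d k) x) \<in> U" for k
        using red(3)[where n = "count (m k) x" and N = "N k"] by (simp add: d_def flip: m)
    qed
    ultimately have "(\<Sum>k\<in>I. scale (c k) (L (N k + replicate_mset (d k) x)))
        + (\<Sum>k\<in>I. scale (c k) (L (m k) - L (N k + replicate_mset (d k) x))) \<in> U"
      by (rule subspace_add[OF U])
    then show ?case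
      by (simp add: scale_right_diff_distrib sum_subtractf)
  qed
qed

text \<open>The form for applications: \<open>h k\<close> has to agree with \<open>L (m k)\<close>
  only modulo \<open>U\<close>. Typically \<open>m k\<close> is the monomial of a word,
  \<open>L\<close> picks a representative in a fixed order, and \<open>U\<close> absorbs the cost of
  reordering.\<close>

lemma (in vector_space) vanishing_monomial_sum:
  fixes m :: "'k \<Rightarrow> 'i multiset"
  assumes U: "subspace U" and "finite I"
    and zero: "\<And>v. (\<Sum>k\<in>I. c k * (\<Prod>i\<in>#m k. v i)) = 0"
    and L: "\<And>k. k \<in> I \<Longrightarrow> h k - L (m k) \<in> U"
    and rel: "\<And>M x. L (M + replicate_mset (field_exp TYPE('a)) x) - L (add_mset x M) \<in> U"
  shows "(\<Sum>k\<in>I. scale (c k) (h k)) \<in> U"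
proof -
  have "(\<Sum>k\<in>I. scale (c k) (L (m k))) + (\<Sum>k\<in>I. scale (c k) (h k - L (m k))) \<in> U"
    using L by (intro subspace_add[OF U] vanishing_monomial_image[OF U \<open>finite I\<close> rel zero]
      subspace_sum[OF U] subspace_scale[OF U])
  then show ?thesis
    by (simp add: scale_right_diff_distrib sum_subtractf)
qed

text \<open>Adjacent swaps generate all rearrangements: the induction hypothesis, applied to
  \<open>P\<close> behind a common head \<open>x\<close>, arranges the rest, and then
  \<open>x\<close> is moved to its place.\<close>

lemma mset_eq_swap_induct:
  assumes "mset l = mset l'"
    and refl: "\<And>l. P l l"
    and trans: "\<And>l1 l2 l3. P l1 l2 \<Longrightarrow> P l2 l3 \<Longrightarrow> P l1 l3"
    and swap: "\<And>u a b w. P (u @ [a, b] @ w) (u @ [b, a] @ w)"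
  shows "P l l'"
  using assms
proof (induction l arbitrary: l' P)
  case Nil
  then show ?case by simp
next
  case (Cons x l)
  note trans' = Cons.prems(3) and swap' = Cons.prems(4)
  have "x \<in> set l'"
    using Cons.prems(1) by (metis list.set_intros(1) mset_eq_setD)
  then obtain u w where l': "l' = u @ x # w"
    by (meson split_list)
  have "P (x # l) (x # u @ w)"
  proof (rule Cons.IH[of "u @ w" "\<lambda>a b. P (x # a) (x # b)"])
    show "P (x # u @ [a, b] @ w) (x # u @ [b, a] @ w)" for u a b w
      using Cons.prems(4)[of "x # u" a b w] by simp
  qed (use Cons.prems l' in \<open>auto intro: Cons.prems(3)\<close>)
  moreover have move: "P (r @ x # u @ w) (r @ u @ x # w)" for r
  proof (induction u arbitrary: r)
    case Nil
    show ?case by (simp add: Cons.prems(2))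
  next
    case (Cons a u)
    have "P (r @ [x, a] @ u @ w) (r @ [a, x] @ u @ w)"
      by (rule swap')
    from trans'[OF this, of "r @ a # u @ x # w"] Cons[of "r @ [a]"] show ?case
      by simp
  qed
  moreover from move[of "[]"] have "P (x # u @ w) (u @ x # w)"
    by simp
  ultimately show ?case
    using trans'[of "x # l" "x # u @ w" "u @ x # w"] l' by simp
qed

text \<open>Used to exhibit a word whose exponents are all divisible by \<open>n\<close> as a
  rearranged \<open>n\<close>-th power.\<close>

lemma repeat_mset_dvd:
  assumes "\<And>a. n dvd count M a"
  obtains M' where "M = repeat_mset n M'" "set_mset M' \<subseteq> set_mset M"
proof
  let ?M' = "\<Sum>a\<in>set_mset M. replicate_mset (count M a div n) a"
  have count: "count ?M' a = count M a div n" for a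
    by (auto simp: count_sum not_in_iff)
  show "M = repeat_mset n ?M'"
    by (rule multiset_eqI) (use assms count in simp)
  show "set_mset ?M' \<subseteq> set_mset M"
  proof
    fix a
    assume "a \<in># ?M'"
    then have "count ?M' a > 0"
      by (simp only: count_greater_zero_iff)
    then show "a \<in># M"
      unfolding count by (metis count_eq_zero_iff div_0 less_irrefl)
  qed
qed

lemma mset_concat_replicate: "mset (concat (replicate n l)) = repeat_mset n (mset l)"
  by (induction n) (simp_all add: multiset_eq_iff)

lemma power_diff_cong:
  fixes a b :: "'b::ring_1"
  assumes "\<And>f g. f \<in> U \<Longrightarrow> g \<in> U \<Longrightarrow> f + g \<in> U" "\<And>f g. f \<in> U \<Longrightarrow> g * f \<in> U"
    "\<And>f g. f \<in> U \<Longrightarrow> f * g \<in> U" "0 \<in> U" "a - b \<in> U"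
  shows "a ^ n - b ^ n \<in> U"
proof (induction n)
  case (Suc n)
  have "a ^ Suc n - b ^ Suc n = (a - b) * a ^ n + b * (a ^ n - b ^ n)"
    by (simp add: algebra_simps)
  then show ?case
    using Suc assms by metis
qed (use assms in simp)

text \<open>Coefficients are attached to indices and not to vectors, so that \<open>h\<close> may
  fail to be injective, as maps from words to elements of the algebra do.\<close>

lemma (in module) span_image_finite_sum:
  assumes "f \<in> span (h ` J)"
  obtains I c where "finite I" "I \<subseteq> J" "f = (\<Sum>i\<in>I. scale (c i) (h i))"
proof -
  from assms have "\<exists>I c. finite I \<and> I \<subseteq> J \<and> f = (\<Sum>i\<in>I. scale (c i) (h i))"
  proof (induction rule: span_induct_alt)
    case base
    show ?case
      by (rule exI[of _ "{}"]) simp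
  next
    case (step c x y)
    then obtain I d i where I: "finite I" "I \<subseteq> J" "y = (\<Sum>i\<in>I. scale (d i) (h i))" "i \<in> J" "x = h i"
      by blast
    let ?d = "\<lambda>j. (if j = i then c else 0) + (if j \<in> I then d j else 0)"
    have "(\<Sum>j\<in>insert i I. scale (?d j) (h j)) =
        (\<Sum>j\<in>insert i I. scale (if j = i then c else 0) (h j)) + (\<Sum>j\<in>insert i I. scale (if j \<in> I then d j else 0) (h j))"
      by (simp add: scale_left_distrib sum.distrib)
    also have "(\<Sum>j\<in>insert i I. scale (if j = i then c else 0) (h j)) = (\<Sum>j\<in>{i}. scale c (h j))"
      using I(1) by (intro sum.mono_neutral_cong_right) auto
    also have "(\<Sum>j\<in>insert i I. scale (if j \<in> I then d j else 0) (h j)) = (\<Sum>j\<in>I. scale (d j) (h j))"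
      using I(1) by (intro sum.mono_neutral_cong_right) auto
    finally have "scale c x + y = (\<Sum>j\<in>insert i I. scale (?d j) (h j))"
      using I by simp
    then show ?case
      using I by (intro exI[of _ "insert i I"] exI[of _ ?d]) auto
  qed
  then show ?thesis
    using that by blast
qed

section \<open>Evaluation and T(*)-spaces\<close>

text \<open>Kept abstract because it is used twice: for the matrices, and for the free algebra
  itself, where \<open>ev\<close> is substitution.\<close>

locale star_algebra = assoc_algebra smul
  for smul :: "'a::field \<Rightarrow> 'b::ring_1 \<Rightarrow> 'b" +
  fixes st :: "'b \<Rightarrow> 'b"
  assumes involution_st: "involution st"
    and st_scale: "st (smul c x) = smul c (st x)"
begin

lemma st_add: "st (x + y) = st x + st y"
  and st_mult: "st (x * y) = st y * st x"
  and st_st [simp]: "st (st x) = x"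
  using involution_st by (auto simp: involution_def)

lemma st_one [simp]: "st 1 = 1"
  by (metis mult_1 mult_1_right st_mult st_st)

abbreviation ev :: "(nat \<Rightarrow> 'b) \<Rightarrow> 'a free_alg \<Rightarrow> 'b"
  where "ev \<equiv> eval_star smul st"

lemma ev_superset:
  assumes "finite X" "Poly_Mapping.keys f \<subseteq> X"
  shows "ev a f = (\<Sum>w\<in>X. smul (Poly_Mapping.lookup f w) (prod_list (map (letter_val st a) (letters w))))"
  unfolding eval_star_def
  by (rule sum.mono_neutral_left) (use assms in \<open>auto simp: in_keys_iff\<close>)

lemma ev_add: "ev a (f + g) = ev a f + ev a g"
proof -
  let ?X = "Poly_Mapping.keys f \<union> Poly_Mapping.keys g"
  have "ev a h = (\<Sum>w\<in>?X. smul (Poly_Mapping.lookup h w) (prod_list (map (letter_val st a) (letters w))))"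
    if "h \<in> {f, g, f + g}" for h
    by (rule ev_superset) (use that Poly_Mapping.keys_add[of f g] in auto)
  then show ?thesis
    by (simp add: lookup_add scale_left_distrib sum.distrib)
qed

lemma ev_single:
  "ev a (Poly_Mapping.single w c) = smul c (prod_list (map (letter_val st a) (letters w)))"
  by (subst ev_superset[of "{w}"]) auto

lemma ev_mult: "ev a (f * g) = ev a f * ev a g"
proof (induction f rule: poly_mapping_induct)
  case (single u c)
  show ?case
  proof (induction g rule: poly_mapping_induct)
    case (single v d)
    show ?case
      by (simp add: mult_single ev_single scale_mult_left scale_mult_right plus_free_word_def)
  qed (simp add: algebra_simps ev_add)
qed (simp add: algebra_simps ev_add)

lemma ev_scale: "ev a (fscale c f) = smul c (ev a f)"
  by (simp add: fscale_def ev_mult ev_single zero_free_word_def scale_mult_left)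

lemma ev_zero [simp]: "ev a 0 = 0"
  by (simp add: eval_star_def)

lemma ev_one [simp]: "ev a 1 = 1"
  by (simp add: ev_single zero_free_word_def flip: single_one)

lemma ev_uminus: "ev a (- f) = - ev a f"
  by (metis add.inverse_unique ev_add ev_zero right_minus)

lemma ev_diff: "ev a (f - g) = ev a f - ev a g"
  by (metis diff_conv_add_uminus ev_add ev_uminus)

lemma ev_power: "ev a (f ^ n) = ev a f ^ n"
  by (induction n) (simp_all add: ev_mult)

lemma ev_sum: "ev a (sum f I) = (\<Sum>i\<in>I. ev a (f i))"
  by (induction I rule: infinite_finite_induct) (simp_all add: ev_add)

lemma ev_gen: "ev a (gen (Var i)) = a i" "ev a (gen (SVar i)) = st (a i)"
  by (simp_all add: gen_def ev_single)

lemmas ev_simps = ev_add ev_mult ev_scale ev_uminus ev_diff ev_power ev_gen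

lemma st_prod_list: "st (prod_list xs) = prod_list (rev (map st xs))"
  by (induction xs) (simp_all add: st_mult)

lemma letter_val_star: "letter_val st a (letter_star l) = st (letter_val st a l)"
  by (cases l) simp_all

lemma ev_fstar: "ev a (fstar f) = st (ev a f)"
proof (induction f rule: poly_mapping_induct)
  case (single w c)
  show ?case
    by (simp add: fstar_single ev_single word_star_def st_scale st_prod_list letter_val_star
        rev_map comp_def)
qed (simp add: fstar_add ev_add st_add)

end

interpretation free: star_algebra fscale fstar
proof -
  interpret assoc_algebra fscale by (rule assoc_algebra_free_alg)
  show "star_algebra fscale fstar"
    by unfold_locales (simp_all add: involution_fstar fstar_scale)
qed

lemma single_eq_prod: "Poly_Mapping.single w c = fscale c (prod_list (map gen (letters w)))"
proof -
  have "prod_list (map gen ls) = Poly_Mapping.single (FWord ls) (1::'a)" for ls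
    by (induction ls)
      (simp_all add: gen_def mult_single plus_free_word_def flip: zero_free_word_def single_one)
  then show ?thesis
    by (simp add: fscale_def mult_single)
qed

context star_algebra
begin

text \<open>Both sides are linear and multiplicative, and they agree on letters because
  \<open>\<phi>\<close> commutes with the star.\<close>

lemma ev_star_endomorphism:
  assumes "star_endomorphism \<phi>"
  shows "ev a (\<phi> f) = ev (\<lambda>i. ev a (\<phi> (gen (Var i)))) f"
proof -
  interpret \<phi>: Vector_Spaces.linear fscale fscale \<phi>
    using assms by (simp add: star_endomorphism_def)
  have mult: "\<phi> (f * g) = \<phi> f * \<phi> g" and one: "\<phi> 1 = 1" and star: "\<phi> (fstar f) = fstar (\<phi> f)" for f g
    using assms by (auto simp: star_endomorphism_def)
  define b where "b = (\<lambda>i. ev a (\<phi> (gen (Var i))))"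
  have letter: "ev a (\<phi> (gen l)) = letter_val st b l" for l
    by (cases l) (simp_all only: letter_val.simps ev_fstar star b_def flip: fstar_gen(1))
  have "ev a (\<phi> f) = ev b f"
  proof (induction f rule: poly_mapping_induct)
    case (single w c)
    have "ev a (\<phi> (prod_list (map gen ls))) = prod_list (map (letter_val st b) ls)" for ls
      by (induction ls) (simp_all add: one mult ev_mult letter)
    then show ?case
      by (simp only: ev_single) (simp only: single_eq_prod \<phi>.scale ev_scale)
  next
    case (sum f g)
    then show ?case by (simp add: \<phi>.add ev_add)
  qed
  then show ?thesis
    by (simp add: b_def)
qed

end

lemma star_endomorphism_ev: "star_endomorphism (eval_star fscale fstar \<sigma>)"
proof -
  have "Vector_Spaces.linear fscale fscale (eval_star fscale fstar \<sigma>)"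
    by unfold_locales (simp_all add: free.ev_simps)
  then show ?thesis
    by (simp add: star_endomorphism_def free.ev_mult free.ev_fstar)
qed

lemma (in star_algebra) ev_ev:
  "ev a (eval_star fscale fstar \<sigma> f) = ev (\<lambda>i. ev a (\<sigma> i)) f"
  by (simp add: ev_star_endomorphism[OF star_endomorphism_ev] free.ev_gen)

lemma T_star_space_TS: "T_star_space (TS_star W)"
proof -
  have "free.subspace (TS_star W)"
    unfolding TS_star_def by (rule free.subspace_Inter) (auto simp: T_star_space_def)
  moreover have "\<phi> f \<in> S" if "star_endomorphism \<phi>" "f \<in> TS_star W" "T_star_space S" "W \<subseteq> S" for \<phi> f S
    using that unfolding TS_star_def T_star_space_def by blast
  ultimately show ?thesis
    by (auto simp: T_star_space_def[of "TS_star W"]) (auto simp: TS_star_def)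
qed

lemma TS_superset: "W \<subseteq> TS_star W"
  by (auto simp: TS_star_def)

lemma TS_least: "T_star_space S \<Longrightarrow> W \<subseteq> S \<Longrightarrow> TS_star W \<subseteq> S"
  by (auto simp: TS_star_def)

lemma TS_subst: "f \<in> TS_star W \<Longrightarrow> eval_star fscale fstar \<sigma> f \<in> TS_star W"
  using T_star_space_TS[of W] star_endomorphism_ev[of \<sigma>] by (auto simp: T_star_space_def)

lemma subspace_TS: "free.subspace (TS_star W)"
  using T_star_space_TS[of W] by (simp add: T_star_space_def)

section \<open>Involutions of the first kind on upper triangular matrices\<close>

lift_definition e11 :: "'a::field ut2 \<Rightarrow> 'a" is "\<lambda>A. A $ 1 $ 1" .
lift_definition e22 :: "'a::field ut2 \<Rightarrow> 'a" is "\<lambda>A. A $ 2 $ 2" .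
lift_definition e12 :: "'a::field ut2 \<Rightarrow> 'a" is "\<lambda>A. A $ 1 $ 2" .

lift_definition mk_ut2 :: "'a::field \<Rightarrow> 'a \<Rightarrow> 'a \<Rightarrow> 'a ut2"
  is "\<lambda>a b c. vector [vector [a, c], vector [0, b]]"
  by (simp add: vector_2)

lemma ut2_eqI:
  assumes "e11 x = e11 y" "e22 x = e22 y" "e12 x = e12 y"
  shows "x = y"
  using assms by transfer (simp add: vec_eq_iff forall_2)

lemma e_mk_ut2 [simp]:
  "e11 (mk_ut2 a b c) = a" "e22 (mk_ut2 a b c) = b" "e12 (mk_ut2 a b c) = c"
  by (transfer; simp add: vector_2)+

lemma e_zero [simp]: "e11 0 = 0" "e22 0 = 0" "e12 0 = 0"
  by (transfer; simp)+

lemma e_one [simp]: "e11 1 = 1" "e22 1 = 1" "e12 1 = 0"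
  by (transfer; simp add: mat_def)+

lemma e_add [simp]: "e11 (x + y) = e11 x + e11 y" "e22 (x + y) = e22 x + e22 y" "e12 (x + y) = e12 x + e12 y"
  by (transfer; simp)+

lemma e_diff [simp]: "e11 (x - y) = e11 x - e11 y" "e22 (x - y) = e22 x - e22 y" "e12 (x - y) = e12 x - e12 y"
  by (transfer; simp)+

lemma e_uminus [simp]: "e11 (- x) = - e11 x" "e22 (- x) = - e22 x" "e12 (- x) = - e12 x"
  by (transfer; simp)+

lemma e_scale [simp]:
  "e11 (ut2_scale c x) = c * e11 x" "e22 (ut2_scale c x) = c * e22 x" "e12 (ut2_scale c x) = c * e12 x"
  by (transfer; simp)+

lemma e_mult [simp]:
  "e11 (x * y) = e11 x * e11 y" "e22 (x * y) = e22 x * e22 y"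
  "e12 (x * y) = e11 x * e12 y + e12 x * e22 y"
  by (transfer; simp add: matrix_matrix_mult_def sum_2)+

lemma e_power [simp]: "e11 (x ^ n) = e11 x ^ n" "e22 (x ^ n) = e22 x ^ n"
  by (induction n) simp_all

lemma alg_center_ut2: "x \<in> alg_center \<longleftrightarrow> e11 x = e22 x \<and> e12 x = 0"
proof
  assume "x \<in> alg_center"
  then have "e12 (x * mk_ut2 0 0 1) = e12 (mk_ut2 0 0 1 * x)" "e12 (x * mk_ut2 1 0 0) = e12 (mk_ut2 1 0 0 * x)"
    by (simp_all add: alg_center_def)
  then show "e11 x = e22 x \<and> e12 x = 0"
    by simp
qed (auto simp: alg_center_def intro!: ut2_eqI)

text \<open>The upper right entry after conjugation by the unipotent matrix with upper right entry
  \<open>- \<nu>\<close>; hence it obeys the same product rule as \<open>e12\<close>.\<close>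

definition k12 :: "'a::field \<Rightarrow> 'a ut2 \<Rightarrow> 'a"
  where "k12 \<nu> x = e12 x + \<nu> * (e11 x - e22 x)"

lemma k12_simps [simp]:
  "k12 \<nu> 0 = 0" "k12 \<nu> 1 = 0" "k12 \<nu> (x + y) = k12 \<nu> x + k12 \<nu> y"
  "k12 \<nu> (x - y) = k12 \<nu> x - k12 \<nu> y" "k12 \<nu> (- x) = - k12 \<nu> x"
  "k12 \<nu> (ut2_scale c x) = c * k12 \<nu> x" "k12 \<nu> (x * y) = e11 x * k12 \<nu> y + k12 \<nu> x * e22 y"
  by (simp_all add: k12_def algebra_simps)

lemma ut2_eqI':
  assumes "e11 x = e11 y" "e22 x = e22 y" "k12 \<nu> x = k12 \<nu> y"
  shows "x = y"
  by (rule ut2_eqI) (use assms in \<open>simp_all add: k12_def\<close>)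

text \<open>Scalar matrices are central, hence fixed by \<open>s\<close>, and multiplying by one of
  them is scaling.\<close>

lemma first_kind_scale:
  assumes "involution s" "first_kind (s :: 'a::field ut2 \<Rightarrow> 'a ut2)"
  shows "s (ut2_scale c x) = ut2_scale c (s x)"
proof -
  have "s (ut2_scale c 1) = ut2_scale c 1"
    using assms(2) by (simp add: first_kind_def alg_center_ut2)
  moreover have "ut2_scale c x = ut2_scale c 1 * x"
    by (rule ut2_eqI) simp_all
  moreover have "ut2_scale c (s x) = s x * ut2_scale c 1"
    by (rule ut2_eqI) simp_all
  ultimately show ?thesis
    using assms(1) by (simp add: involution_def)
qed

lemma star_algebra_ut2:
  assumes "involution s" "first_kind (s :: 'a::field ut2 \<Rightarrow> 'a ut2)"
  shows "star_algebra ut2_scale s"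
proof -
  interpret assoc_algebra ut2_scale by (rule assoc_algebra_ut2)
  show ?thesis
    by unfold_locales (use assms first_kind_scale in auto)
qed

text \<open>Up to the change of coordinates \<open>k12 \<nu>\<close>, induced by an inner automorphism, there are only two
  involutions of the first kind.\<close>

lemma ut2_involution_coords:
  fixes s :: "'a::field ut2 \<Rightarrow> 'a ut2"
  assumes two: "(2::'a) \<noteq> 0" and "involution s" "first_kind s"
  obtains \<epsilon> \<nu> where "\<epsilon> = 1 \<or> \<epsilon> = -1" "\<And>x. e11 (s x) = e22 x" "\<And>x. e22 (s x) = e11 x"
    "\<And>x. k12 \<nu> (s x) = \<epsilon> * k12 \<nu> x"
proof -
  interpret star_algebra ut2_scale s
    using assms by (intro star_algebra_ut2)
  define E where "E = (mk_ut2 0 0 1 :: 'a ut2)"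
  define P where "P = (mk_ut2 1 0 0 :: 'a ut2)"
  define \<epsilon> where "\<epsilon> = e12 (s E)"
  define \<mu> where "\<mu> = e12 (s P)"
  have E [simp]: "e11 E = 0" "e22 E = 0" "e12 E = 1" and P [simp]: "e11 P = 1" "e22 P = 0" "e12 P = 0"
    by (simp_all add: E_def P_def)
  have st_zero: "s 0 = 0"
    using st_add[of 0 0] by simp
  \<comment> \<open>The products of the matrix units \<open>E\<close> and \<open>P\<close> are
    carried over with the order reversed; this determines the diagonals of \<open>s E\<close> and
    \<open>s P\<close>.\<close>
  have "E * E = 0" "P * E = E" "E * P = 0"
    by (rule ut2_eqI; simp)+
  then have rel: "s E * s E = 0" "s E * s P = s E" "s P * s E = 0"
    by (metis st_mult st_zero)+
  have sE: "e11 (s E) = 0" "e22 (s E) = 0"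
    using arg_cong[OF rel(1), of e11] arg_cong[OF rel(1), of e22] by simp_all
  have "s E = ut2_scale \<epsilon> E"
    by (rule ut2_eqI) (simp_all add: sE \<epsilon>_def)
  then have "E = ut2_scale \<epsilon> (s E)"
    by (metis st_st st_scale)
  then have "\<epsilon> * \<epsilon> = 1"
    using E(3) e_scale(3)[of \<epsilon> "s E"] by (simp only: \<epsilon>_def)
  then have \<epsilon>: "\<epsilon> = 1 \<or> \<epsilon> = -1" and "\<epsilon> \<noteq> 0"
    by (auto simp: square_eq_1_iff)
  have sP: "e22 (s P) = 1" "e11 (s P) = 0"
    using arg_cong[OF rel(2), of e12] arg_cong[OF rel(3), of e12] \<open>\<epsilon> \<noteq> 0\<close> by (simp_all add: sE flip: \<epsilon>_def)
  have decomp: "x = ut2_scale (e11 x) P + (ut2_scale (e22 x) (1 + ut2_scale (-1) P) + ut2_scale (e12 x) E)" for x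
    by (rule ut2_eqI) simp_all
  have s: "s x = ut2_scale (e11 x) (s P) + (ut2_scale (e22 x) (1 + ut2_scale (-1) (s P)) + ut2_scale (e12 x) (s E))" for x
    by (subst decomp[of x]) (simp only: st_add st_scale st_one)
  \<comment> \<open>The upper right entry of \<open>s (s P) = P\<close> is 0.\<close>
  have \<mu>: "\<mu> * (\<epsilon> - 1) = 0"
    using arg_cong[OF s[of "s P"], of e12] by (simp add: sP sE algebra_simps flip: \<epsilon>_def \<mu>_def)
  show ?thesis
  \<comment> \<open>Half of \<open>\<mu>\<close> is the right shift: the difference of the diagonal
    entries changes sign under \<open>s\<close>, so the correction counts twice. If
    \<open>\<epsilon> = -1\<close>, the relation just found forces \<open>\<mu> = 0\<close>.\<close>
  proof (rule that[of \<epsilon> "\<mu> / 2"])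
    show "\<epsilon> = 1 \<or> \<epsilon> = -1"
      by (fact \<epsilon>)
    fix x
    show e: "e11 (s x) = e22 x" "e22 (s x) = e11 x"
      by (simp_all add: s[of x] sP sE)
    define h where "h = \<mu> / 2"
    have h: "\<mu> = h + h"
      using two by (simp add: h_def flip: mult_2)
    have "h * (\<epsilon> - 1) = 0"
      using \<mu> two by (simp add: h_def)
    then have "\<epsilon> = 1 \<or> h = 0"
      by auto
    moreover have "e12 (s x) = \<mu> * (e11 x - e22 x) + \<epsilon> * e12 x"
      by (simp add: s[of x] algebra_simps flip: \<epsilon>_def \<mu>_def)
    ultimately show "k12 (\<mu> / 2) (s x) = \<epsilon> * k12 (\<mu> / 2) x"
      unfolding h_def[symmetric] by (auto simp: k12_def e h algebra_simps)
  qed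
qed

text \<open>Fixes the coordinates found in \<open>ut2_involution_coords\<close>; the sign
  \<open>\<epsilon>\<close> is specialised in \<open>ut2_skew\<close> and
  \<open>ut2_sym\<close>.\<close>

locale ut2_star =
  fixes s :: "'a::field ut2 \<Rightarrow> 'a ut2" and \<epsilon> \<nu> :: 'a and q :: nat
  assumes two: "(2::'a) \<noteq> 0" and q: "q = field_exp TYPE('a)" and s: "involution s" "first_kind s"
    and e_s: "\<And>x. e11 (s x) = e22 x" "\<And>x. e22 (s x) = e11 x"
    and k_s: "\<And>x. k12 \<nu> (s x) = \<epsilon> * k12 \<nu> x"

sublocale ut2_star \<subseteq> star_algebra ut2_scale s
  using s by (rule star_algebra_ut2)

section \<open>Words in symmetric and skew generators\<close>

definition Y :: "nat \<Rightarrow> 'a::field free_alg"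
  where "Y i = gen (Var i) + gen (SVar i)"

definition Z :: "nat \<Rightarrow> 'a::field free_alg"
  where "Z i = gen (Var i) - gen (SVar i)"

text \<open>The letters are reused to index symmetric and skew generators.\<close>

fun yz :: "letter \<Rightarrow> 'a::field free_alg"
  where
    "yz (Var i) = Y i"
  | "yz (SVar i) = Z i"

definition yzw :: "letter list \<Rightarrow> 'a::field free_alg"
  where "yzw l = prod_list (map yz l)"

lemma yzw_simps [simp]:
  "yzw [] = 1" "yzw (a # l) = yz a * yzw l" "yzw (l @ l') = yzw l * yzw l'" "yzw (replicate n a) = yz a ^ n"
  by (simp_all add: yzw_def)

lemma fstar_YZ: "fstar (Y i) = (Y i :: 'a::field free_alg)" "fstar (Z i) = - (Z i :: 'a free_alg)"
proof -
  have "fstar (- f) = - fstar f" for f :: "'a free_alg"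
  proof -
    have "fstar f + fstar (- f) = 0"
      using fstar_add[of f "- f"] fstar_add[of "0 :: 'a free_alg" 0] by simp
    then show ?thesis
      by (metis minus_unique)
  qed
  then show "fstar (Y i) = (Y i :: 'a free_alg)" "fstar (Z i) = - (Z i :: 'a free_alg)"
    by (simp_all add: Y_def Z_def fstar_add fstar_gen diff_conv_add_uminus del: add_uminus_conv_diff)
qed

fun is_skew :: "letter \<Rightarrow> bool"
  where
    "is_skew (Var i) = False"
  | "is_skew (SVar i) = True"

definition zdeg :: "letter multiset \<Rightarrow> nat"
  where "zdeg M = size (filter_mset is_skew M)"

lemma zdeg_simps [simp]:
  "zdeg {#} = 0" "zdeg (add_mset a M) = (if is_skew a then Suc (zdeg M) else zdeg M)"
  "zdeg (M + N) = zdeg M + zdeg N" "zdeg (replicate_mset n a) = (if is_skew a then n else 0)"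
  by (induction n) (simp_all add: zdeg_def)

lemma zdeg_eq_0_iff: "zdeg M = 0 \<longleftrightarrow> (\<forall>a\<in>#M. \<not> is_skew a)"
  by (induction M) auto

lemma zdeg_pos_split:
  assumes "zdeg M > 0"
  obtains j N where "M = add_mset (SVar j) N"
proof -
  have "zdeg M \<noteq> 0"
    using assms by simp
  then obtain a where "a \<in># M" "is_skew a"
    unfolding zdeg_eq_0_iff by blast
  then show ?thesis
    using that by (cases a) (auto dest: multi_member_split)
qed

lemma yzw_concat_replicate: "yzw (concat (replicate n l)) = yzw l ^ n"
  by (induction n) simp_all

text \<open>The star reverses the word and puts a sign on each skew letter; the signs cancel in even
  degree.\<close>

lemma fstar_yzw:
  assumes "even (zdeg (mset l))"
  shows "fstar (yzw l) = (yzw (rev l) :: 'a::field free_alg)"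
proof -
  have minus: "fstar (- f) = - fstar f" for f :: "'a free_alg"
    using fstar_scale[of "-1" f] by simp
  have "fstar (yzw l) = fscale ((-1) ^ zdeg (mset l)) (yzw (rev l) :: 'a free_alg)"
  proof (induction l)
    case (Cons a l)
    then show ?case
      by (cases a) (simp_all add: free.st_mult fstar_YZ free.scale_mult_left)
  qed simp
  then show ?thesis
    using assms by simp
qed

text \<open>Each free generator is half the sum or half the difference of \<open>Y i\<close> and
  \<open>Z i\<close>, so the span is stable under left multiplication by free generators.\<close>

lemma free_alg_span_yzw:
  assumes "(2::'a::field) \<noteq> 0"
  shows "(f::'a free_alg) \<in> free.span (range yzw)"
proof -
  have mult: "yz a * f \<in> free.span (range yzw)" if "f \<in> free.span (range yzw)" for a and f :: "'a free_alg"
    using that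
  proof (induction rule: free.span_induct_alt)
    case (step c x y)
    then obtain l where "x = yzw l" by auto
    then have "yz a * (fscale c x + y) = fscale c (yzw (a # l)) + yz a * y"
      by (simp add: distrib_left free.scale_mult_right)
    moreover have "fscale c (yzw (a # l)) + yz a * y \<in> free.span (range yzw)"
      by (intro free.span_add free.span_scale free.span_base rangeI step.IH)
    ultimately show ?case
      by (simp only:)
  qed (simp add: free.span_zero)
  have half: "fscale (1 / 2) (g + g) = (g :: 'a free_alg)" for g
    using assms by (simp flip: free.scale_left_distrib[of "1/2" "1/2"] add: free.scale_right_distrib field_simps)
  have gen: "gen l * f \<in> free.span (range yzw)" if f: "f \<in> free.span (range yzw)" for l and f :: "'a free_alg"
  proof (cases l)
    case (Var i)
    have "gen l * f = fscale (1 / 2) (yz (Var i) * f + yz (SVar i) * f)"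
      using half[of "gen l * f"] by (simp add: Var Y_def Z_def algebra_simps)
    then show ?thesis
      by (simp only:) (intro free.span_add free.span_scale mult f)
  next
    case (SVar i)
    have "gen l * f = fscale (1 / 2) (yz (Var i) * f - yz (SVar i) * f)"
      using half[of "gen l * f"] by (simp add: SVar Y_def Z_def algebra_simps)
    then show ?thesis
      by (simp only:) (intro free.span_diff free.span_scale mult f)
  qed
  have "prod_list (map gen l) \<in> free.span (range (yzw :: _ \<Rightarrow> 'a free_alg))" for l
  proof (induction l)
    case Nil
    show ?case
      using free.span_base[OF rangeI, of yzw "[]"] by simp
  qed (simp add: gen)
  then show ?thesis
    by (induction f rule: poly_mapping_induct)
      (simp_all only: single_eq_prod free.span_add free.span_scale)
qed

definition comm :: "'b::ring \<Rightarrow> 'b \<Rightarrow> 'b"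
  where "comm f g = f * g - g * f"

lemma comm_swap: "comm f g = - comm g f"
  by (simp add: comm_def)

text \<open>\<open>subst_inner u v js\<close> substitutes \<open>u\<close> and \<open>v\<close> for the first two variables, which serve as the
  outer factors of a generated ideal, and renames the remaining variables along \<open>js\<close>.\<close>

definition subst_inner :: "'a::field free_alg \<Rightarrow> 'a free_alg \<Rightarrow> nat list \<Rightarrow> nat \<Rightarrow> 'a free_alg"
  where "subst_inner u v js i = (if i = 0 then u else if i = 1 then v else gen (Var (js ! (i - 2))))"

lemma ev_subst_inner [simp]:
  "free.ev (subst_inner u v js) (gen (Var 0)) = u"
  "free.ev (subst_inner u v js) (gen (Var 1)) = v"
  "free.ev (subst_inner u v js) (gen (Var (Suc 0))) = v"
  "i \<ge> 2 \<Longrightarrow> free.ev (subst_inner u v js) (Y i) = Y (js ! (i - 2))"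
  "i \<ge> 2 \<Longrightarrow> free.ev (subst_inner u v js) (Z i) = Z (js ! (i - 2))"
  by (auto simp: free.ev_gen subst_inner_def Y_def Z_def free.ev_simps fstar_gen)

section \<open>Identities whose generated ideal lies in a T-star-space\<close>

context star_algebra
begin

text \<open>\<open>TS_star W\<close> is only a subspace; this part of it is a two-sided ideal, so
  congruences modulo it may be multiplied from both sides. Its elements are also required to be
  identities, so that they vanish on evaluation.\<close>

definition T_ideal :: "'a free_alg set \<Rightarrow> 'a free_alg set"
  where "T_ideal W = {f. (\<forall>x. ev x f = 0) \<and> (\<forall>u v. u * f * v \<in> TS_star W)}"

lemma T_ideal_ev: "f \<in> T_ideal W \<Longrightarrow> ev x f = 0"
  by (simp add: T_ideal_def)

lemma T_ideal_subset: "f \<in> T_ideal W \<Longrightarrow> f \<in> TS_star W"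
  unfolding T_ideal_def by (metis (no_types, lifting) mem_Collect_eq mult_1 mult_1_right)

lemma subspace_T_ideal: "free.subspace (T_ideal W)"
proof (rule free.subspaceI)
  show "0 \<in> T_ideal W"
    by (simp add: T_ideal_def free.subspace_0 subspace_TS)
  show "f + g \<in> T_ideal W" if "f \<in> T_ideal W" "g \<in> T_ideal W" for f g
    using that by (simp add: T_ideal_def ev_add distrib_left distrib_right free.subspace_add subspace_TS)
  show "fscale c f \<in> T_ideal W" if "f \<in> T_ideal W" for c f
    using that
    by (simp add: T_ideal_def ev_scale free.scale_mult_left free.scale_mult_right free.subspace_scale subspace_TS)
qed

lemmas T_ideal_add = free.subspace_add[OF subspace_T_ideal]
  and T_ideal_diff = free.subspace_diff[OF subspace_T_ideal]
  and T_ideal_neg = free.subspace_neg[OF subspace_T_ideal]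
  and T_ideal_scale = free.subspace_scale[OF subspace_T_ideal]
  and T_ideal_0 = free.subspace_0[OF subspace_T_ideal]
  and T_ideal_sum = free.subspace_sum[OF subspace_T_ideal]

lemma T_ideal_left: "f \<in> T_ideal W \<Longrightarrow> u * f \<in> T_ideal W"
  by (simp add: T_ideal_def ev_mult flip: mult.assoc)

lemma T_ideal_right: "f \<in> T_ideal W \<Longrightarrow> f * u \<in> T_ideal W"
  by (simp add: T_ideal_def ev_mult) (simp add: mult.assoc)

text \<open>By \<open>eq\<close>, the image of \<open>r\<close> does not depend on what is put for
  the first two variables; the generator with its outer factors thus yields
  \<open>u * r' * v\<close> for all \<open>u\<close> and \<open>v\<close>.\<close>

lemma T_ideal_intro:
  assumes W: "gen (Var 0) * r * gen (Var 1) \<in> W" and r: "\<And>x. ev x r = 0"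
    and eq: "\<And>u v. free.ev (subst_inner u v js) r = r'"
  shows "r' \<in> T_ideal W"
proof -
  have "u * r' * v \<in> TS_star W" for u v
    using TS_subst[of "gen (Var 0) * r * gen (Var 1)" W "subst_inner u v js"] W TS_superset[of W]
    by (auto simp: free.ev_mult eq)
  moreover have "ev x r' = 0" for x
    using r by (metis ev_ev eq)
  ultimately show ?thesis
    by (simp add: T_ideal_def)
qed

end

section \<open>Reordering words\<close>

definition rep :: "'i multiset \<Rightarrow> 'i list"
  where "rep M = (SOME l. mset l = M)"

lemma mset_rep [simp]: "mset (rep M) = M"
  unfolding rep_def by (rule someI_ex) (rule ex_mset)

text \<open>Each swap of neighbours costs a word with one commutator. The right factor
  \<open>X\<close> lets the same argument serve bare words, with \<open>X = 1\<close>, and words in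
  front of a fixed element.\<close>

lemma yzw_swap_mult:
  assumes U: "free.subspace U" and "mset l = M" "mset l' = M"
    and swap: "\<And>u a b w. mset (u @ [a, b] @ w) = M \<Longrightarrow>
      yzw u * (comm (yz a) (yz b) * (yzw w * X)) \<in> U"
  shows "yzw l * X - yzw l' * X \<in> U"
proof -
  have "mset l = M \<longrightarrow> yzw l * X - yzw l' * X \<in> U \<and> mset l' = M"
    using assms(2,3)
  proof (intro mset_eq_swap_induct[where P = "\<lambda>l l'. mset l = M \<longrightarrow> yzw l * X - yzw l' * X \<in> U \<and> mset l' = M" and l = l and l' = l'])
    fix l1 l2 l3
    assume "mset l1 = M \<longrightarrow> yzw l1 * X - yzw l2 * X \<in> U \<and> mset l2 = M"
      "mset l2 = M \<longrightarrow> yzw l2 * X - yzw l3 * X \<in> U \<and> mset l3 = M"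
    then show "mset l1 = M \<longrightarrow> yzw l1 * X - yzw l3 * X \<in> U \<and> mset l3 = M"
      using free.subspace_add[OF U, of "yzw l1 * X - yzw l2 * X" "yzw l2 * X - yzw l3 * X"] by auto
  next
    fix u :: "letter list" and a b w
    have "yzw (u @ [a, b] @ w) * X - yzw (u @ [b, a] @ w) * X
        = yzw u * (comm (yz a) (yz b) * (yzw w * X))"
      by (simp add: comm_def algebra_simps)
    then show "mset (u @ [a, b] @ w) = M \<longrightarrow>
      yzw (u @ [a, b] @ w) * X - yzw (u @ [b, a] @ w) * X \<in> U \<and> mset (u @ [b, a] @ w) = M"
      using swap[of u a b w] by (auto simp: add_mset_commute)
  qed (use free.subspace_0[OF U] in auto)
  then show ?thesis
    using assms by blast
qed

section \<open>Coordinates of the values of words\<close>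

context ut2_star
begin

lemma odd_q: "odd q"
  unfolding q using two by (rule odd_field_exp)

lemma power_q: "(t::'a) ^ q = t"
  by (simp add: q power_field_exp)

lemma q_pos: "q > 0"
  by (simp add: q field_exp_pos)

lemma Suc_q_pred [simp]: "Suc (q - Suc 0) = q"
  using q_pos by simp

lemma power_q_pred: "t ^ (q - Suc 0) * t = (t::'a)" "t * t ^ (q - Suc 0) = t"
  by (simp_all add: power_q field_exp_pos flip: power_Suc2 power_Suc)

lemma ev_zeroI:
  assumes "\<And>x. e11 (ev x f) = 0" "\<And>x. e22 (ev x f) = 0" "\<And>x. k12 \<nu> (ev x f) = 0"
  shows "ev x f = 0"
  by (rule ut2_eqI'[of _ _ \<nu>]) (simp_all add: assms)

lemma ev_Y: "e11 (ev x (Y i)) = e11 (x i) + e22 (x i)" "e22 (ev x (Y i)) = e11 (x i) + e22 (x i)"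
    "k12 \<nu> (ev x (Y i)) = (1 + \<epsilon>) * k12 \<nu> (x i)"
  and ev_Z: "e11 (ev x (Z i)) = e11 (x i) - e22 (x i)" "e22 (ev x (Z i)) = e22 (x i) - e11 (x i)"
    "k12 \<nu> (ev x (Z i)) = (1 - \<epsilon>) * k12 \<nu> (x i)"
  by (simp_all add: Y_def Z_def ev_simps e_s k_s algebra_simps)

lemma e22_yz: "e22 (ev x (yz a)) = (if is_skew a then - e11 (ev x (yz a)) else e11 (ev x (yz a)))"
  by (cases a) (simp_all add: ev_Y ev_Z)

lemma e11_yzw: "e11 (ev x (yzw l)) = (\<Prod>a\<in>#mset l. e11 (ev x (yz a)))"
  by (induction l) (simp_all add: ev_mult)

lemma e22_yzw: "e22 (ev x (yzw l)) = (-1) ^ zdeg (mset l) * (\<Prod>a\<in>#mset l. e11 (ev x (yz a)))"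
  by (induction l) (simp_all add: ev_mult e22_yz)

text \<open>The source of all test points used to compare coefficients. The coordinate is halved
  because one of \<open>Y i\<close> and \<open>Z i\<close>, depending on the sign
  \<open>\<epsilon>\<close>, doubles it.\<close>

lemma assignment:
  obtains x where "\<And>a. e11 (ev x (yz a)) = v a" "\<And>i. k12 \<nu> (x i) = c i / 2"
proof
  \<comment> \<open>Sum and difference of the diagonal entries are the values wanted for
    \<open>Y i\<close> and \<open>Z i\<close>; the last entry compensates the shift in
    \<open>k12\<close>.\<close>
  let ?x = "\<lambda>i. mk_ut2 ((v (Var i) + v (SVar i)) / 2) ((v (Var i) - v (SVar i)) / 2) (c i / 2 - \<nu> * v (SVar i))"
  have half: "t / 2 + t / 2 = t" for t :: 'a
    using two by (simp flip: mult_2)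
  show "e11 (ev ?x (yz a)) = v a" for a
    using half[of "v a"] by (cases a) (simp_all add: ev_Y ev_Z add_divide_distrib diff_divide_distrib)
  show "k12 \<nu> (?x i) = c i / 2" for i
    using half[of "v (SVar i)"] by (simp add: k12_def add_divide_distrib diff_divide_distrib)
qed

text \<open>With opposite diagonal entries, \<open>z ^ 2\<close> is scalar, so even powers have no
  off-diagonal part.\<close>

lemma k12_power_skew:
  assumes "e22 z = - e11 z"
  shows "k12 \<nu> (z ^ n) = (if odd n then e11 z ^ (n - 1) * k12 \<nu> z else 0)"
proof (induction n)
  case (Suc n)
  then show ?case
    by (cases n) (auto simp: assms)
qed simp

text \<open>Here \<open>z\<close> is a scalar plus a square-zero element, so the formal derivative
  of the power appears.\<close>

lemma k12_power_sym:
  assumes "e22 z = e11 z"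
  shows "k12 \<nu> (z ^ n) = of_nat n * e11 z ^ (n - 1) * k12 \<nu> z"
proof (induction n)
  case (Suc n)
  then show ?case
    by (cases n) (auto simp: assms algebra_simps)
qed simp

lemma halve:
  assumes "free.subspace U" "f + f \<in> U"
  shows "(f :: 'a free_alg) \<in> U"
proof -
  have "f + f = fscale 2 f"
    using free.scale_left_distrib[of 1 1 f] by simp
  then have "f = fscale (1 / 2) (f + f)"
    using two by simp
  then show ?thesis
    using free.subspace_scale[OF assms] by metis
qed

lemma free_alg_words:
  obtains I c where "finite I" "(f :: 'a free_alg) = (\<Sum>l\<in>I. fscale (c l) (yzw l))"
  using free.span_image_finite_sum[OF free_alg_span_yzw[OF two, of f]] by blast

lemma e11_words: "e11 (ev x (\<Sum>l\<in>I. fscale (c l) (yzw l))) = (\<Sum>l\<in>I. c l * (\<Prod>a\<in>#mset l. e11 (ev x (yz a))))"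
  by (induction I rule: infinite_finite_induct) (simp_all add: ev_simps e11_yzw)

lemma central_iff:
  "f \<in> star_central_polys ut2_scale s \<longleftrightarrow>
    (\<forall>x. e11 (ev x f) = e22 (ev x f) \<and> k12 \<nu> (ev x f) = 0)"
proof -
  have "z \<in> alg_center \<longleftrightarrow> e11 z = e22 z \<and> k12 \<nu> z = 0" for z
    by (auto simp: alg_center_ut2 k12_def)
  then show ?thesis
    by (simp add: star_central_polys_def)
qed

lemma T_star_space_central: "T_star_space (star_central_polys ut2_scale s)"
  unfolding T_star_space_def
proof (intro conjI allI impI)
  show "free.subspace (star_central_polys ut2_scale s)"
    by (rule free.subspaceI) (auto simp: central_iff ev_simps)
  show "\<phi> ` star_central_polys ut2_scale s \<subseteq> star_central_polys ut2_scale s" if "star_endomorphism \<phi>" for \<phi>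
  proof safe
    fix f
    assume "f \<in> star_central_polys ut2_scale s"
    then have "e11 (ev b f) = e22 (ev b f) \<and> k12 \<nu> (ev b f) = 0" for b
      by (simp add: central_iff)
    then show "\<phi> f \<in> star_central_polys ut2_scale s"
      unfolding central_iff by (subst (1 2 3) ev_star_endomorphism[OF that]) blast
  qed
qed

lemma T_ideal_central: "f \<in> T_ideal W \<Longrightarrow> f \<in> star_central_polys ut2_scale s"
  by (simp add: central_iff T_ideal_ev)

end

text \<open>What the two cases have in common: modulo the ideal, a commutator of generators moves
  past a generator up to a scalar. The scalars that occur are 1, -1 and 0.\<close>

locale ut2_gens = ut2_star +
  fixes W :: "'a free_alg set"
  assumes comm_pass_letter:
    "\<And>a b d. \<exists>c. comm (yz a) (yz b) * yz d - fscale c (yz d * comm (yz a) (yz b)) \<in> T_ideal W"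
begin

lemma comm_pass:
  "\<exists>c. comm (yz a) (yz b) * yzw l - fscale c (yzw l * comm (yz a) (yz b)) \<in> T_ideal W"
proof (induction l)
  case Nil
  have "comm (yz a) (yz b) * yzw [] - fscale 1 (yzw [] * comm (yz a) (yz b)) \<in> T_ideal W"
    by (simp add: T_ideal_0)
  then show ?case ..
next
  case (Cons d l)
  let ?C = "comm (yz a) (yz b)"
  obtain c where c: "?C * yzw l - fscale c (yzw l * ?C) \<in> T_ideal W"
    using Cons by blast
  obtain c' where c': "?C * yz d - fscale c' (yz d * ?C) \<in> T_ideal W"
    using comm_pass_letter by blast
  have "?C * yzw (d # l) - fscale (c' * c) (yzw (d # l) * ?C)
      = (?C * yz d - fscale c' (yz d * ?C)) * yzw l + fscale c' (yz d * (?C * yzw l - fscale c (yzw l * ?C)))"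
    by (simp add: algebra_simps free.scale_mult_left free.scale_mult_right free.scale_right_diff_distrib)
  also have "\<dots> \<in> T_ideal W"
    by (intro T_ideal_add T_ideal_right T_ideal_scale T_ideal_left c c')
  finally show ?case ..
qed

text \<open>In front of such an element letters commute modulo the ideal, since the commutator
  created by a swap can be moved next to it. The examples are commutators and the elements
  \<open>gz\<close> and \<open>gy\<close>.\<close>

definition nil_elem :: "'a free_alg \<Rightarrow> bool"
  where "nil_elem e \<longleftrightarrow> (\<forall>a b. comm (yz a) (yz b) * e \<in> T_ideal W)"

lemma nil_swap:
  assumes "nil_elem e"
  shows "comm (yz a) (yz b) * (yzw l * e) \<in> T_ideal W"
proof -
  let ?C = "comm (yz a) (yz b)"
  obtain c where c: "?C * yzw l - fscale c (yzw l * ?C) \<in> T_ideal W"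
    using comm_pass by blast
  have "?C * (yzw l * e) = (?C * yzw l - fscale c (yzw l * ?C)) * e + fscale c (yzw l * (?C * e))"
    by (simp add: algebra_simps free.scale_mult_left)
  also have "\<dots> \<in> T_ideal W"
    using assms
    by (intro T_ideal_add T_ideal_right[OF c] T_ideal_scale T_ideal_left[where f = "?C * e"]) (simp add: nil_elem_def)
  finally show ?thesis .
qed

lemma nil_perm:
  assumes "nil_elem e" "mset l = mset l'"
  shows "yzw l * e - yzw l' * e \<in> T_ideal W"
  by (rule yzw_swap_mult[OF subspace_T_ideal, of _ "mset l"])
    (use assms in \<open>auto intro: T_ideal_left nil_swap\<close>)

lemma nil_letter_last:
  assumes "nil_elem e" "a \<in> set l"
  obtains l' where "mset l = add_mset a (mset l')" "yzw l * e - yzw l' * (yz a * e) \<in> T_ideal W"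
proof -
  obtain l1 l2 where l: "l = l1 @ a # l2"
    using assms(2) by (meson split_list)
  have "yzw l * e - yzw ((l1 @ l2) @ [a]) * e \<in> T_ideal W"
    by (rule nil_perm[OF assms(1)]) (simp add: l)
  then show ?thesis
    by (intro that[of "l1 @ l2"]) (simp_all add: l mult.assoc)
qed

text \<open>Supplies the relation \<open>t ^ q = t\<close> that
  \<open>vanishing_monomial_sum\<close> asks for, for words in front of \<open>e\<close>.\<close>

lemma nil_power:
  assumes "nil_elem e" "(yz x ^ q - yz x) * e \<in> T_ideal W"
  shows "yzw (rep (M + replicate_mset q x)) * e - yzw (rep (add_mset x M)) * e \<in> T_ideal W"
proof -
  have "yzw (rep (M + replicate_mset q x)) * e - yzw (rep M @ replicate q x) * e \<in> T_ideal W"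
    "yzw (rep M @ [x]) * e - yzw (rep (add_mset x M)) * e \<in> T_ideal W"
    by (rule nil_perm[OF assms(1)]; simp)+
  then have "(yzw (rep (M + replicate_mset q x)) * e - yzw (rep M @ replicate q x) * e)
      + yzw (rep M) * ((yz x ^ q - yz x) * e)
      + (yzw (rep M @ [x]) * e - yzw (rep (add_mset x M)) * e) \<in> T_ideal W"
    by (intro T_ideal_add T_ideal_left[OF assms(2)])
  then show ?thesis
    by (simp add: algebra_simps)
qed

end

section \<open>The involution that negates the upper right entry\<close>

locale ut2_skew = ut2_star +
  assumes eps: "\<epsilon> = -1"
begin

text \<open>With \<open>z = t (e\<^sub>1\<^sub>1 - e\<^sub>2\<^sub>2) + c e\<^sub>1\<^sub>2\<close>, the value of \<open>gz\<close> is \<open>(1 - t\<^sup>q\<^sup>-\<^sup>1) c e\<^sub>1\<^sub>2\<close>; it is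
  zero over an infinite field, where \<open>q = 1\<close>.\<close>

definition gz :: "nat \<Rightarrow> 'a free_alg"
  where "gz i = Z i - Z i ^ q"

text \<open>Variables 0 and 1 are reserved for the outer factors, hence the numbering from 2. The
  relation containing \<open>Z 2 * gz 3\<close> twice exchanges a \<open>gz\<close> for a
  commutator.\<close>

definition skew_ids :: "'a free_alg set"
  where "skew_ids = {comm (Y 2) (Y 3), comm (Y 2) (Z 3),
    Z 2 * comm (Z 3) (Z 4) + comm (Z 3) (Z 4) * Z 2,
    comm (Z 2) (Z 3) * comm (Z 4) (Z 5),
    Z 2 * comm (Z 3) (Z 4) - Z 3 * comm (Z 2) (Z 4) + Z 4 * comm (Z 2) (Z 3),
    Y 2 ^ q - Y 2, Z 2 * gz 2,
    Z 2 * gz 3 + Z 2 * gz 3 - (1 - Z 3 ^ (q - 1)) * comm (Z 2) (Z 3),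
    comm (Z 2) (Z 3) * gz 4, gz 2 * comm (Z 3) (Z 4), gz 2 * gz 3}"

definition skew_gens :: "'a free_alg set"
  where "skew_gens = insert (Y 0) ((\<lambda>r. gen (Var 0) * r * gen (Var 1)) ` skew_ids)"

abbreviation T :: "'a free_alg set"
  where "T \<equiv> T_ideal skew_gens"

lemma ev_gz: "e11 (ev x (gz i)) = 0" "e22 (ev x (gz i)) = 0"
    "k12 \<nu> (ev x (gz i)) = (1 - e11 (ev x (Z i)) ^ (q - 1)) * k12 \<nu> (ev x (Z i))"
  by (simp_all add: gz_def ev_simps ev_Z power_q k12_power_skew odd_q algebra_simps)

lemma ev_comm_Z: "e11 (ev x (comm (Z i) (Z j))) = 0" "e22 (ev x (comm (Z i) (Z j))) = 0"
    "k12 \<nu> (ev x (comm (Z i) (Z j))) = 2 * (e11 (ev x (Z i)) * k12 \<nu> (ev x (Z j)) - e11 (ev x (Z j)) * k12 \<nu> (ev x (Z i)))"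
  by (simp_all add: comm_def ev_simps ev_Z algebra_simps)

lemma ev_skew_ids:
  assumes "r \<in> skew_ids"
  shows "ev x r = 0"
proof -
  have e22: "e22 (ev x (Z i)) = - e11 (ev x (Z i))" for x i
    by (simp add: ev_Z)
  have pred: "t ^ (q - Suc 0) * (t * u) = t * u" for t u :: 'a
    using power_q_pred(1)[of t] by (simp flip: mult.assoc)
  have kY: "k12 \<nu> (ev x (Y i)) = 0" for x i
    by (simp add: ev_Y eps)
  have "ev x (comm (Y 2) (Y 3)) = 0" "ev x (comm (Y 2) (Z 3)) = 0"
    by (rule ev_zeroI; simp add: comm_def ev_simps ev_Y ev_Z eps algebra_simps)+
  moreover have "ev x (Y 2 ^ q - Y 2) = 0"
    by (rule ev_zeroI) (simp_all add: ev_simps ev_Y power_q k12_power_sym eps)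
  moreover have "ev x (Z 2 * comm (Z 3) (Z 4) + comm (Z 3) (Z 4) * Z 2) = 0"
    "ev x (comm (Z 2) (Z 3) * comm (Z 4) (Z 5)) = 0"
    "ev x (Z 2 * comm (Z 3) (Z 4) - Z 3 * comm (Z 2) (Z 4) + Z 4 * comm (Z 2) (Z 3)) = 0"
    "ev x (comm (Z 2) (Z 3) * gz 4) = 0" "ev x (gz 2 * comm (Z 3) (Z 4)) = 0" "ev x (gz 2 * gz 3) = 0"
    by (rule ev_zeroI; simp add: ev_simps ev_comm_Z ev_gz e22; simp add: algebra_simps pred power_q_pred)+
  moreover have "ev x (Z 2 * gz 2) = 0"
    by (rule ev_zeroI; use power_q_pred(1)[of "e11 (ev _ (Z 2))"] in \<open>auto simp: ev_simps ev_gz\<close>)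
  moreover have "ev x (Z 2 * gz 3 + Z 2 * gz 3 - (1 - Z 3 ^ (q - 1)) * comm (Z 2) (Z 3)) = 0"
  proof (rule ev_zeroI)
    show "k12 \<nu> (ev x (Z 2 * gz 3 + Z 2 * gz 3 - (1 - Z 3 ^ (q - 1)) * comm (Z 2) (Z 3))) = 0" for x
    \<comment> \<open>A nonzero diagonal value \<open>t\<close> of \<open>Z 3\<close> satisfies
      \<open>t ^ (q - 1) = 1\<close>, and then all terms vanish.\<close>
    proof (cases "e11 (ev x (Z 3)) = 0")
      case False
      then have "e11 (ev x (Z 3)) ^ (q - Suc 0) = 1"
        using power_q_pred(1)[of "e11 (ev x (Z 3))"] by simp
      then show ?thesis
        by (simp add: ev_simps ev_comm_Z ev_gz e22)
    qed (simp add: ev_simps ev_comm_Z ev_gz e22 algebra_simps)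
  qed (simp_all add: ev_simps ev_comm_Z ev_gz e22)
  ultimately show ?thesis
    using assms unfolding skew_ids_def by blast
qed

lemma skew_T:
  assumes "r \<in> skew_ids" "\<And>u v. free.ev (subst_inner u v js) r = free.ev (subst_inner 0 0 js) r"
  shows "free.ev (subst_inner 0 0 js) r \<in> T"
  by (rule T_ideal_intro[where r = r and js = js]) (use assms ev_skew_ids in \<open>auto simp: skew_gens_def\<close>)

lemma T_identities:
  "comm (Y i) (Y j) \<in> T" "comm (Y i) (Z j) \<in> T"
  "Z i * comm (Z j) (Z k) + comm (Z j) (Z k) * Z i \<in> T"
  "comm (Z i) (Z j) * comm (Z k) (Z l) \<in> T"
  "Z i * comm (Z j) (Z k) - Z j * comm (Z i) (Z k) + Z k * comm (Z i) (Z j) \<in> T"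
  "Y i ^ q - Y i \<in> T" "Z i * gz i \<in> T"
  "Z i * gz j + Z i * gz j - (1 - Z j ^ (q - 1)) * comm (Z i) (Z j) \<in> T"
  "comm (Z i) (Z j) * gz k \<in> T" "gz i * comm (Z j) (Z k) \<in> T" "gz i * gz j \<in> T"
proof -
  have "\<forall>r\<in>skew_ids. (\<forall>u v. free.ev (subst_inner u v [i, j, k, l]) r = free.ev (subst_inner 0 0 [i, j, k, l]) r)
      \<longrightarrow> free.ev (subst_inner 0 0 [i, j, k, l]) r \<in> T"
    using skew_T by blast
  then show "comm (Y i) (Y j) \<in> T" "comm (Y i) (Z j) \<in> T"
    "Z i * comm (Z j) (Z k) + comm (Z j) (Z k) * Z i \<in> T"
    "comm (Z i) (Z j) * comm (Z k) (Z l) \<in> T"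
    "Z i * comm (Z j) (Z k) - Z j * comm (Z i) (Z k) + Z k * comm (Z i) (Z j) \<in> T"
    "Y i ^ q - Y i \<in> T" "Z i * gz i \<in> T"
    "Z i * gz j + Z i * gz j - (1 - Z j ^ (q - 1)) * comm (Z i) (Z j) \<in> T"
    "comm (Z i) (Z j) * gz k \<in> T" "gz i * comm (Z j) (Z k) \<in> T" "gz i * gz j \<in> T"
    by (simp_all add: skew_ids_def comm_def gz_def free.ev_simps)
qed

lemma T_comm:
  assumes "\<not> (is_skew a \<and> is_skew b)"
  shows "comm (yz a) (yz b) \<in> T"
proof (cases a)
  case (Var i)
  then show ?thesis
    by (cases b) (simp_all add: T_identities)
next
  case (SVar i)
  with assms obtain j where "b = Var j"
    by (cases b) auto
  then show ?thesis
    using SVar T_ideal_neg[OF T_identities(2)[of j i]] by (simp flip: comm_swap)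
qed

text \<open>A symmetric generator commutes with the commutator by the Jacobi identity, as its
  commutators with generators lie in \<open>T\<close>; a skew generator anticommutes with a
  commutator of skew ones.\<close>

lemma skew_pass_letter:
  "\<exists>c. comm (yz a) (yz b) * yz d - fscale c (yz d * comm (yz a) (yz b)) \<in> T"
proof (cases "is_skew a \<and> is_skew b")
  case False
  then have "comm (yz a) (yz b) * yz d - fscale 0 (yz d * comm (yz a) (yz b)) \<in> T"
    by (simp add: T_comm T_ideal_right)
  then show ?thesis ..
next
  case True
  then obtain i j where ab: "a = SVar i" "b = SVar j"
    by (cases a; cases b) auto
  show ?thesis
  proof (cases d)
    case (Var k)
    have "comm (yz a) (yz b) * yz d - fscale 1 (yz d * comm (yz a) (yz b))
        = Z j * comm (Y k) (Z i) + comm (Y k) (Z j) * Z i - (Z i * comm (Y k) (Z j) + comm (Y k) (Z i) * Z j)"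
      by (simp add: comm_def ab Var algebra_simps)
    also have "\<dots> \<in> T"
      by (intro T_ideal_diff T_ideal_add T_ideal_left T_ideal_right T_identities)
    finally show ?thesis ..
  next
    case (SVar k)
    have "comm (yz a) (yz b) * yz d - fscale (-1) (yz d * comm (yz a) (yz b))
        = Z k * comm (Z i) (Z j) + comm (Z i) (Z j) * Z k"
      by (simp add: ab SVar)
    also have "\<dots> \<in> T"
      by (rule T_identities)
    finally show ?thesis ..
  qed
qed

end

sublocale ut2_skew \<subseteq> ut2_gens s \<epsilon> \<nu> q skew_gens
  by unfold_locales (rule skew_pass_letter)

section \<open>Words with one commutator or one \<open>gz\<close>\<close>

context ut2_skew
begin

lemma nil_comm: "nil_elem (comm (Z i) (Z j))" and nil_gz: "nil_elem (gz i)"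
proof -
  have "comm (yz a) (yz b) * comm (Z i) (Z j) \<in> T \<and> comm (yz a) (yz b) * gz i \<in> T" for a b
  proof (cases "is_skew a \<and> is_skew b")
    case True
    then show ?thesis
      by (cases a; cases b) (auto simp: T_identities)
  qed (auto simp: T_comm T_ideal_right)
  then show "nil_elem (comm (Z i) (Z j))" "nil_elem (gz i)"
    by (auto simp: nil_elem_def)
qed

text \<open>Words containing \<open>Z m\<close> are left out because \<open>Z m * gz m\<close> lies
  in \<open>T\<close>; this leaves the diagonal value of \<open>Z m\<close> free to be set to
  0.\<close>

definition gz_span :: "nat \<Rightarrow> 'a free_alg set"
  where "gz_span m = free.span ((\<lambda>l. yzw l * gz m) ` {l. SVar m \<notin> set l} \<union> T)"

text \<open>What arises when words containing \<open>Z m\<close> are reordered and their exponents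
  reduced. Giving every commutator the first argument \<open>Z m\<close> makes the coefficients
  readable from the values.\<close>

definition comm_span :: "nat \<Rightarrow> 'a free_alg set"
  where "comm_span m = free.span ((\<lambda>(j, l). yzw l * comm (Z m) (Z j)) ` UNIV
    \<union> ((\<lambda>l. yzw l * gz m) ` {l. SVar m \<notin> set l} \<union> T))"

lemma subspace_gz_span: "free.subspace (gz_span m)"
  and subspace_comm_span: "free.subspace (comm_span m)"
  by (simp_all add: gz_span_def comm_span_def)

lemmas comm_span_add = free.subspace_add[OF subspace_comm_span]
  and comm_span_diff = free.subspace_diff[OF subspace_comm_span]
  and comm_span_neg = free.subspace_neg[OF subspace_comm_span]
  and comm_span_scale = free.subspace_scale[OF subspace_comm_span]

lemma T_gz_span: "f \<in> T \<Longrightarrow> f \<in> gz_span m"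
  by (auto simp: gz_span_def intro: free.span_base)

lemma gz_span_base: "SVar m \<notin> set l \<Longrightarrow> yzw l * gz m \<in> gz_span m"
  by (auto simp: gz_span_def intro: free.span_base)

lemma gz_span_subset: "f \<in> gz_span m \<Longrightarrow> f \<in> comm_span m"
  unfolding gz_span_def comm_span_def by (meson free.span_mono subsetD Un_upper2)

lemma T_comm_span: "f \<in> T \<Longrightarrow> f \<in> comm_span m"
  by (simp add: T_gz_span gz_span_subset)

lemma comm_span_base: "yzw l * comm (Z m) (Z j) \<in> comm_span m"
  unfolding comm_span_def by (rule free.span_base) force

text \<open>If \<open>Z m\<close> occurs only in the word in front, the identity
  \<open>Z m [Z i, Z j] = Z i [Z m, Z j] - Z j [Z m, Z i]\<close> moves it into the
  commutators.\<close>

lemma comm_span_comm: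
  assumes "SVar m = a \<or> SVar m = b \<or> SVar m \<in> set l"
  shows "yzw l * comm (yz a) (yz b) \<in> comm_span m"
proof (cases "is_skew a \<and> is_skew b")
  case False
  then show ?thesis
    by (intro T_comm_span T_ideal_left T_comm)
next
  case True
  then obtain i j where ab: "a = SVar i" "b = SVar j"
    by (cases a; cases b) auto
  consider "i = m" | "j = m" | "SVar m \<in> set l"
    using assms ab by auto
  then show ?thesis
  proof cases
    case 1
    then show ?thesis
      by (simp add: ab comm_span_base)
  next
    case 2
    then show ?thesis
      using comm_span_neg[OF comm_span_base[of l m i]] by (simp add: ab comm_swap[of "Z i"])
  next
    case 3
    obtain l' where l': "yzw l * comm (Z i) (Z j) - yzw l' * (yz (SVar m) * comm (Z i) (Z j)) \<in> T"
      using nil_letter_last[OF nil_comm 3] by metis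
    have "yzw l * comm (Z i) (Z j) = (yzw l * comm (Z i) (Z j) - yzw l' * (yz (SVar m) * comm (Z i) (Z j)))
      + yzw l' * (Z m * comm (Z i) (Z j) - Z i * comm (Z m) (Z j) + Z j * comm (Z m) (Z i))
      + (yzw (l' @ [SVar i]) * comm (Z m) (Z j) - yzw (l' @ [SVar j]) * comm (Z m) (Z i))"
      by (simp add: algebra_simps)
    also have "\<dots> \<in> comm_span m"
      by (intro comm_span_add comm_span_diff comm_span_base T_comm_span[OF l'] T_comm_span[OF T_ideal_left] T_identities)
    finally show ?thesis
      by (simp add: ab)
  qed
qed

text \<open>A \<open>Z m\<close> in the word is moved next to \<open>gz k\<close>; modulo
  \<open>T\<close>, twice the product \<open>Z m * gz k\<close> is a combination of
  commutators.\<close>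

lemma comm_span_gz:
  assumes "k = m \<or> SVar m \<in> set l"
  shows "yzw l * gz k \<in> comm_span m"
proof (cases "SVar m \<in> set l")
  case False
  then show ?thesis
    using assms by (auto intro: gz_span_subset gz_span_base)
next
  case True
  obtain l' where l': "yzw l * gz k - yzw l' * (yz (SVar m) * gz k) \<in> T"
    using nil_letter_last[OF nil_gz True] by metis
  have "yzw l' * (Z m * gz k) \<in> comm_span m"
  proof (rule halve[OF subspace_comm_span])
    have "yzw l' * (Z m * gz k) + yzw l' * (Z m * gz k)
      = yzw l' * (Z m * gz k + Z m * gz k - (1 - Z k ^ (q - 1)) * comm (Z m) (Z k))
        + (yzw l' * comm (Z m) (Z k) - yzw (l' @ replicate (q - 1) (SVar k)) * comm (Z m) (Z k))"
      by (simp add: algebra_simps)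
    also have "\<dots> \<in> comm_span m"
      by (intro comm_span_add comm_span_diff comm_span_base T_comm_span[OF T_ideal_left] T_identities)
    finally show "yzw l' * (Z m * gz k) + yzw l' * (Z m * gz k) \<in> comm_span m" .
  qed
  from comm_span_add[OF T_comm_span[OF l'] this] show ?thesis
    by simp
qed

text \<open>The commutator from each swap is moved to the end of the word. As \<open>Z m\<close>
  occurs in the commutator or in the rest, \<open>comm_span_comm\<close> applies.\<close>

lemma comm_span_perm:
  assumes "SVar m \<in># M" "mset l = M" "mset l' = M"
  shows "yzw l - yzw l' \<in> comm_span m"
proof -
  have "yzw l * 1 - yzw l' * 1 \<in> comm_span m"
  proof (rule yzw_swap_mult[OF subspace_comm_span assms(2,3)])
    fix u :: "letter list" and a b w
    assume eq: "mset (u @ [a, b] @ w) = M"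
    let ?C = "comm (yz a) (yz b)"
    obtain c where c: "?C * yzw w - fscale c (yzw w * ?C) \<in> T"
      using comm_pass by blast
    have "yzw u * (?C * (yzw w * 1)) = yzw u * (?C * yzw w - fscale c (yzw w * ?C)) + fscale c (yzw (u @ w) * ?C)"
      by (simp add: algebra_simps free.scale_mult_right)
    also have "\<dots> \<in> comm_span m"
      using assms(1) unfolding eq[symmetric]
      by (intro comm_span_add comm_span_scale comm_span_comm T_comm_span[OF T_ideal_left] c) auto
    finally show "yzw u * (?C * (yzw w * 1)) \<in> comm_span m" .
  qed
  then show ?thesis by simp
qed

lemma comm_span_power:
  assumes "SVar m \<in># add_mset x M"
  shows "yzw (rep (M + replicate_mset q x)) - yzw (rep (add_mset x M)) \<in> comm_span m"
proof -
  have m: "SVar m \<in># M + replicate_mset q x"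
    using assms q_pos by auto
  have "yzw (rep M) * (yz x ^ q - yz x) \<in> comm_span m"
  proof (cases x)
    case (Var i)
    then show ?thesis
      by (simp add: T_comm_span T_ideal_left T_identities)
  next
    case (SVar k)
    then have "yzw (rep M) * gz k \<in> comm_span m"
      using assms by (intro comm_span_gz) (auto simp flip: set_mset_mset)
    from comm_span_neg[OF this] show ?thesis
      by (simp add: SVar gz_def algebra_simps)
  qed
  moreover have "yzw (rep (M + replicate_mset q x)) - yzw (rep M @ replicate q x) \<in> comm_span m"
    by (rule comm_span_perm[OF m]) simp_all
  moreover have "yzw (rep M @ [x]) - yzw (rep (add_mset x M)) \<in> comm_span m"
    by (rule comm_span_perm[OF assms]) simp_all
  ultimately have "yzw (rep M) * (yz x ^ q - yz x) + (yzw (rep (M + replicate_mset q x)) - yzw (rep M @ replicate q x))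
      + (yzw (rep M @ [x]) - yzw (rep (add_mset x M))) \<in> comm_span m"
    by (intro comm_span_add)
  then show ?thesis
    by (simp add: algebra_simps)
qed

text \<open>The upper left entry of the value is the commutative polynomial belonging to the words,
  so this polynomial vanishes as a function; reordering and reducing exponents cost only elements of
  \<open>comm_span m\<close>.\<close>

lemma identity_comm_span:
  assumes "finite I" "\<And>l. l \<in> I \<Longrightarrow> SVar m \<in> set l"
    and zero: "\<And>x. ev x (\<Sum>l\<in>I. fscale (c l) (yzw l)) = 0"
  shows "(\<Sum>l\<in>I. fscale (c l) (yzw l)) \<in> comm_span m"
\<comment> \<open>The power relation is required of all multisets, but words without
  \<open>Z m\<close> cannot be reordered modulo \<open>comm_span m\<close>; the default 0 takes care
  of them.\<close>
proof (rule free.vanishing_monomial_sum[OF subspace_comm_span \<open>finite I\<close>,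
      where m = mset and L = "\<lambda>M. if SVar m \<in># M then yzw (rep M) else 0"])
  fix v :: "letter \<Rightarrow> 'a"
  obtain x where "\<And>a. e11 (ev x (yz a)) = v a"
    using assignment by blast
  then show "(\<Sum>l\<in>I. c l * (\<Prod>a\<in>#mset l. v a)) = 0"
    using arg_cong[OF zero[of x], of e11] by (simp add: e11_words)
next
  fix l
  assume "l \<in> I"
  then show "yzw l - (if SVar m \<in># mset l then yzw (rep (mset l)) else 0) \<in> comm_span m"
    using comm_span_perm[of m "mset l" l "rep (mset l)"] assms(2) by simp
next
  fix M x
  show "(if SVar m \<in># M + replicate_mset (field_exp TYPE('a)) x
        then yzw (rep (M + replicate_mset (field_exp TYPE('a)) x)) else 0)
      - (if SVar m \<in># add_mset x M then yzw (rep (add_mset x M)) else 0) \<in> comm_span m"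
    using comm_span_power[of m x M] q_pos free.subspace_0[OF subspace_comm_span] unfolding q[symmetric] by auto
qed

text \<open>The off-diagonal coordinate of \<open>gz m\<close> is proportional to that of
  \<open>x m\<close>; setting the latter to zero hides this part of
  \<open>comm_span m\<close>.\<close>

lemma k12_gz_span:
  assumes "f \<in> gz_span m" "k12 \<nu> (x m) = 0"
  shows "k12 \<nu> (ev x f) = 0"
  using assms(1) unfolding gz_span_def
proof (induction rule: free.span_induct_alt)
  case (step c f g)
  have "k12 \<nu> (ev x f) = 0"
    using step.hyps assms(2) by (auto simp: ev_simps ev_gz ev_Z T_ideal_ev)
  then show ?case
    using step by (simp add: ev_simps)
qed simp

text \<open>The monomial of \<open>yzw l * [Z m, Z j]\<close> has an extra \<open>Z m\<close> coming
  from the commutator. If all \<open>Z m\<close> belong to the power being reduced,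
  \<open>Z m ^ (q - 1)\<close> has to be removed in front of the commutator, at the cost of terms
  ending in \<open>Z j * gz m\<close>.\<close>

lemma gz_span_power:
  assumes "j \<noteq> m"
  shows "(if SVar m \<in># M + replicate_mset q x
        then yzw (rep (M + replicate_mset q x - {#SVar m#})) * comm (Z m) (Z j) else 0)
      - (if SVar m \<in># add_mset x M then yzw (rep (add_mset x M - {#SVar m#})) * comm (Z m) (Z j) else 0)
      \<in> gz_span m"
proof -
  let ?C = "comm (Z m) (Z j)"
  consider "SVar m \<in># M" | "SVar m \<notin># M" "x = SVar m" | "SVar m \<notin># M" "x \<noteq> SVar m"
    by blast
  then show ?thesis
  proof cases
    case 1
    then obtain N where N: "M = add_mset (SVar m) N"
      by (meson mset_add)
    have "(yz x ^ q - yz x) * ?C \<in> T"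
    proof (cases x)
      case (SVar k)
      have "(yz x ^ q - yz x) * ?C = - (gz k * ?C)"
        by (simp add: SVar gz_def algebra_simps)
      then show ?thesis
        by (simp add: T_ideal_neg T_identities)
    qed (simp add: T_ideal_right T_identities)
    then have "yzw (rep (N + replicate_mset q x)) * ?C - yzw (rep (add_mset x N)) * ?C \<in> T"
      by (rule nil_power[OF nil_comm])
    moreover have "add_mset x (add_mset (SVar m) N) - {#SVar m#} = add_mset x N"
      by (simp add: add_mset_commute)
    ultimately show ?thesis
      by (simp add: N T_gz_span)
  next
    case 2
    note m = 2(1) and x = 2(2)
    have M: "M + replicate_mset q x - {#SVar m#} = M + replicate_mset (q - 1) x"
      using x q_pos by (cases q) simp_all
    let ?r = "Z j * gz m + Z j * gz m - (1 - Z m ^ (q - 1)) * comm (Z j) (Z m)"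
    let ?g = "yzw (rep M @ [SVar j]) * gz m"
    have 1: "yzw (rep (M + replicate_mset (q - 1) x)) * ?C - yzw (rep M @ replicate (q - 1) x) * ?C \<in> T"
      by (rule nil_perm[OF nil_comm]) simp
    have 2: "yzw (rep M) * ?r \<in> T"
      by (rule T_ideal_left) (rule T_identities)
    have 3: "?g \<in> gz_span m"
      using m assms by (intro gz_span_base) (simp flip: set_mset_mset)
    have "((yzw (rep (M + replicate_mset (q - 1) x)) * ?C - yzw (rep M @ replicate (q - 1) x) * ?C)
        - yzw (rep M) * ?r) + (?g + ?g) \<in> gz_span m"
      by (rule free.subspace_add[OF subspace_gz_span T_gz_span[OF T_ideal_diff[OF 1 2]]
            free.subspace_add[OF subspace_gz_span 3 3]])
    then have "yzw (rep (M + replicate_mset (q - 1) x)) * ?C - yzw (rep M) * ?C \<in> gz_span m"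
      by (simp add: x comm_swap[of "Z j"] algebra_simps)
    then show ?thesis
      using M x m q_pos by simp
  next
    case 3
    then show ?thesis
      using free.subspace_0[OF subspace_gz_span] by simp
  qed
qed

text \<open>Off-diagonal value 1 for \<open>Z j\<close> and 0 for the other skew generators isolates
  the commutators \<open>[Z m, Z j]\<close> and, as \<open>j \<noteq> m\<close>, hides the
  \<open>gz m\<close> part.\<close>

lemma comm_span_identity:
  assumes f: "f \<in> comm_span m" and zero: "\<And>x. ev x f = 0"
  shows "f \<in> gz_span m"
proof -
  let ?h = "\<lambda>(j, l). yzw l * comm (Z m) (Z j)"
  obtain g h where g: "g \<in> free.span (?h ` UNIV)" and h: "h \<in> gz_span m" and fgh: "f = g + h"
    using f unfolding comm_span_def gz_span_def free.span_Un[of "?h ` UNIV"] by blast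
  obtain I c where I: "finite I" "g = (\<Sum>p\<in>I. fscale (c p) (?h p))"
    using free.span_image_finite_sum[OF g] by blast
  have part: "(\<Sum>p\<in>{p \<in> I. fst p = j}. fscale (c p) (?h p)) \<in> gz_span m" for j
  proof (cases "j = m")
    case True
    then have "(\<Sum>p\<in>{p \<in> I. fst p = j}. fscale (c p) (?h p)) = 0"
      by (intro sum.neutral) (auto simp: comm_def)
    then show ?thesis
      using free.subspace_0[OF subspace_gz_span] by simp
  next
    case False
    let ?J = "{p \<in> I. fst p = j}"
    let ?L = "\<lambda>M. if SVar m \<in># M then yzw (rep (M - {#SVar m#})) * comm (Z m) (Z j) else 0"
    show ?thesis
    proof (rule free.vanishing_monomial_sum[OF subspace_gz_span,
          where m = "\<lambda>p. add_mset (SVar m) (mset (snd p))" and L = ?L])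
      show "finite ?J"
        using I by simp
      show "?L (M + replicate_mset (field_exp TYPE('a)) x) - ?L (add_mset x M) \<in> gz_span m" for M x
        using gz_span_power[OF False, of M x] unfolding q[symmetric] .
      show "?h p - ?L (add_mset (SVar m) (mset (snd p))) \<in> gz_span m" if "p \<in> ?J" for p
        using that nil_perm[OF nil_comm, of "snd p" "rep (mset (snd p))" m j]
        by (cases p) (simp add: T_gz_span)
      fix v :: "letter \<Rightarrow> 'a"
      obtain x where x: "\<And>a. e11 (ev x (yz a)) = v a" "\<And>i. k12 \<nu> (x i) = (if i = j then 1 else 0) / 2"
        using assignment[of v "\<lambda>i. if i = j then 1 else 0"] by blast
      have kZ: "k12 \<nu> (ev x (Z i)) = (if i = j then 1 else 0)" for i
        using two by (simp add: ev_Z x eps)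
      have vZ: "e11 (ev x (Z i)) = v (SVar i)" for i
        using x(1)[of "SVar i"] by simp
      have "k12 \<nu> (ev x (?h p)) = (if fst p = j then 2 * (\<Prod>a\<in>#add_mset (SVar m) (mset (snd p)). v a) else 0)" for p
        using False by (cases p) (simp add: ev_mult ev_comm_Z kZ vZ e11_yzw x algebra_simps)
      then have "k12 \<nu> (ev x g) = (\<Sum>p\<in>I. c p * (if fst p = j then 2 * (\<Prod>a\<in>#add_mset (SVar m) (mset (snd p)). v a) else 0))"
        unfolding I(2) by (induction I rule: infinite_finite_induct) (simp_all add: ev_simps)
      also have "\<dots> = 2 * (\<Sum>p\<in>?J. c p * (\<Prod>a\<in>#add_mset (SVar m) (mset (snd p)). v a))"
        using I(1) by (simp add: sum_distrib_left sum.inter_filter mult.left_commute if_distrib cong: if_cong)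
      finally have "2 * (\<Sum>p\<in>?J. c p * (\<Prod>a\<in>#add_mset (SVar m) (mset (snd p)). v a)) = k12 \<nu> (ev x g)"
        by simp
      also have "\<dots> = 0"
        using arg_cong[OF zero[of x], of "k12 \<nu>"] k12_gz_span[OF h, of x] False
        by (simp add: fgh ev_add x)
      finally show "(\<Sum>p\<in>?J. c p * (\<Prod>a\<in>#add_mset (SVar m) (mset (snd p)). v a)) = 0"
        using two by simp
    qed
  qed
  have "g = (\<Sum>j\<in>fst ` I. \<Sum>p\<in>{p \<in> I. fst p = j}. fscale (c p) (?h p))"
    unfolding I(2) by (rule sum.image_gen) (rule I)
  also have "\<dots> \<in> gz_span m"
    by (intro free.subspace_sum[OF subspace_gz_span] part)
  finally show ?thesis
    unfolding fgh using h by (rule free.subspace_add[OF subspace_gz_span])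
qed

text \<open>Let \<open>Z m\<close> have diagonal value 0 and off-diagonal value 1. If
  \<open>q > 1\<close>, then \<open>gz m\<close> has off-diagonal value 1, and the words, being free
  of \<open>Z m\<close>, contribute their monomials. If \<open>q = 1\<close>, then
  \<open>gz m\<close> is 0.\<close>

lemma gz_span_identity:
  assumes f: "f \<in> gz_span m" and zero: "\<And>x. ev x f = 0"
  shows "f \<in> T"
proof -
  let ?h = "\<lambda>l. yzw l * gz m"
  obtain g h where g: "g \<in> free.span (?h ` {l. SVar m \<notin> set l})" and h: "h \<in> T" and fgh: "f = g + h"
    using f unfolding gz_span_def free.span_Un free.span_eq_iff[THEN iffD2, OF subspace_T_ideal] by blast
  obtain I c where I: "finite I" "I \<subseteq> {l. SVar m \<notin> set l}" "g = (\<Sum>l\<in>I. fscale (c l) (?h l))"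
    using free.span_image_finite_sum[OF g] by blast
  have "g \<in> T"
  proof (cases "q = 1")
    case True
    then have "Z m ^ q = (Z m :: 'a free_alg)"
      by simp
    then have "gz m = 0"
      by (simp add: gz_def)
    then show ?thesis
      by (simp add: I T_ideal_0)
  next
    case False
    let ?L = "\<lambda>M. if SVar m \<notin># M then yzw (rep M) * gz m else 0"
    have "(\<Sum>l\<in>I. fscale (c l) (?h l)) \<in> T"
    proof (rule free.vanishing_monomial_sum[OF subspace_T_ideal \<open>finite I\<close>, where m = mset and L = ?L])
      show "?h l - ?L (mset l) \<in> T" if "l \<in> I" for l
        using that nil_perm[OF nil_gz, of l "rep (mset l)" m] I(2) by auto
      show "?L (M + replicate_mset (field_exp TYPE('a)) x) - ?L (add_mset x M) \<in> T" for M x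
      proof (cases "SVar m \<in># add_mset x M")
        case True
        then show ?thesis
          using q_pos unfolding q[symmetric] by (auto simp: T_ideal_0)
      next
        case m: False
        have "(yz x ^ q - yz x) * gz m \<in> T"
        proof (cases x)
          case (SVar k)
          have "(yz x ^ q - yz x) * gz m = - (gz k * gz m)"
            by (simp add: SVar gz_def algebra_simps)
          then show ?thesis
            by (simp add: T_ideal_neg T_identities)
        qed (simp add: T_ideal_right T_identities)
        then show ?thesis
          using m nil_power[OF nil_gz, of x m M] unfolding q[symmetric] by auto
      qed
      fix v :: "letter \<Rightarrow> 'a"
      obtain x where x: "\<And>a. e11 (ev x (yz a)) = (v(SVar m := 0)) a" "\<And>i. k12 \<nu> (x i) = 1 / 2"
        using assignment[of "v(SVar m := 0)" "\<lambda>i. 1"] by blast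
      have "q - Suc 0 > 0"
        using False q_pos by linarith
      then have "(0::'a) ^ (q - Suc 0) = 0"
        by (simp add: zero_power)
      then have "k12 \<nu> (ev x (gz m)) = 1"
        using x(1)[of "SVar m"] x(2)[of m] two by (simp add: ev_gz ev_Z(3) eps mult.commute)
      moreover have "(\<Prod>a\<in>#mset l. e11 (ev x (yz a))) = (\<Prod>a\<in>#mset l. v a)" if "l \<in> I" for l
        by (intro arg_cong[of _ _ prod_mset] image_mset_cong) (use that I(2) x(1) in auto)
      ultimately have "k12 \<nu> (ev x (?h l)) = (\<Prod>a\<in>#mset l. v a)" if "l \<in> I" for l
        using that by (simp add: ev_mult ev_gz(2) e11_yzw)
      then have "(\<Sum>l\<in>I. c l * (\<Prod>a\<in>#mset l. v a)) = (\<Sum>l\<in>I. c l * k12 \<nu> (ev x (?h l)))"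
        by (intro sum.cong) auto
      also have "\<dots> = k12 \<nu> (ev x g)"
        unfolding I(3) by (induction I rule: infinite_finite_induct) (simp_all add: ev_simps)
      also have "\<dots> = 0"
        using zero[of x] by (simp add: fgh ev_add T_ideal_ev[OF h])
      finally show "(\<Sum>l\<in>I. c l * (\<Prod>a\<in>#mset l. v a)) = 0" .
    qed
    then show ?thesis
      by (simp add: I(3))
  qed
  then show ?thesis
    unfolding fgh using h by (rule T_ideal_add)
qed

section \<open>Identities without skew generators, then by induction on the skew generators\<close>

lemma T_perm_Var:
  assumes "zdeg M = 0" "mset l = M" "mset l' = M"
  shows "yzw l - yzw l' \<in> T"
proof -
  have "yzw l * 1 - yzw l' * 1 \<in> T"
  proof (rule yzw_swap_mult[OF subspace_T_ideal assms(2,3)])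
    fix u :: "letter list" and a b w
    assume "mset (u @ [a, b] @ w) = M"
    then have "zdeg (mset (u @ [a, b] @ w)) = 0"
      using assms(1) by simp
    then have "\<not> (is_skew a \<and> is_skew b)"
      by (auto split: if_splits)
    then show "yzw u * (comm (yz a) (yz b) * (yzw w * 1)) \<in> T"
      by (intro T_ideal_left T_ideal_right T_comm)
  qed
  then show ?thesis by simp
qed

text \<open>Without skew letters, reordering and \<open>Y i ^ q = Y i\<close> hold modulo
  \<open>T\<close> itself, so the upper left entry decides.\<close>

lemma identity_T_Var:
  assumes "finite I" "\<And>l. l \<in> I \<Longrightarrow> zdeg (mset l) = 0"
    and zero: "\<And>x. ev x (\<Sum>l\<in>I. fscale (c l) (yzw l)) = 0"
  shows "(\<Sum>l\<in>I. fscale (c l) (yzw l)) \<in> T"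
proof -
  let ?L = "\<lambda>M. if zdeg M = 0 then yzw (rep M) else 0"
  show ?thesis
  proof (rule free.vanishing_monomial_sum[OF subspace_T_ideal \<open>finite I\<close>, where m = mset and L = ?L])
    fix v :: "letter \<Rightarrow> 'a"
    obtain x where "\<And>a. e11 (ev x (yz a)) = v a"
      using assignment by blast
    then show "(\<Sum>l\<in>I. c l * (\<Prod>a\<in>#mset l. v a)) = 0"
      using arg_cong[OF zero[of x], of e11] by (simp add: e11_words)
  next
    show "yzw l - ?L (mset l) \<in> T" if "l \<in> I" for l
      using that T_perm_Var[of "mset l" l "rep (mset l)"] assms(2) by simp
    show "?L (M + replicate_mset (field_exp TYPE('a)) x) - ?L (add_mset x M) \<in> T" for M x
    proof (cases "zdeg (add_mset x M) = 0")
      case False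
      then show ?thesis
        using q_pos unfolding q[symmetric] by (auto simp: T_ideal_0 split: if_splits)
    next
      case True
      then obtain i where i: "x = Var i"
        by (cases x) auto
      have M: "zdeg M = 0"
        using True i by simp
      have 1: "yzw (rep (M + replicate_mset q x)) - yzw (rep M @ replicate q x) \<in> T"
        by (rule T_perm_Var[where M = "M + replicate_mset q x"]) (simp_all only: mset_rep, simp_all add: M i)
      have 2: "yzw (rep M @ [x]) - yzw (rep (add_mset x M)) \<in> T"
        by (rule T_perm_Var[where M = "add_mset x M"]) (simp_all only: mset_rep, simp_all add: M i)
      from 1 2 have "(yzw (rep (M + replicate_mset q x)) - yzw (rep M @ replicate q x))
          + yzw (rep M) * (Y i ^ q - Y i) + (yzw (rep M @ [x]) - yzw (rep (add_mset x M))) \<in> T"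
        by (intro T_ideal_add T_ideal_left[OF T_identities(6)])
      then show ?thesis
        unfolding q[symmetric] by (simp add: M i algebra_simps)
    qed
  qed
qed

text \<open>The words without \<open>Z m\<close> form an identity by themselves, as \<open>Z m\<close> can be set to zero; hence every
  word may be assumed to contain \<open>Z m\<close>.\<close>

lemma identity_T_words:
  assumes "finite X" "finite I" "\<And>l m. l \<in> I \<Longrightarrow> SVar m \<in> set l \<Longrightarrow> m \<in> X"
    and "\<And>x. ev x (\<Sum>l\<in>I. fscale (c l) (yzw l)) = 0"
  shows "(\<Sum>l\<in>I. fscale (c l) (yzw l)) \<in> T"
  using assms
proof (induction X arbitrary: I rule: finite_induct)
  case empty
  have "zdeg (mset l) = 0" if "l \<in> I" for l
  proof -
    have "\<not> is_skew a" if "a \<in> set l" for a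
      using empty.prems(2)[OF \<open>l \<in> I\<close>] that by (cases a) auto
    then show ?thesis
      by (simp add: zdeg_eq_0_iff)
  qed
  then show ?case
    using empty.prems by (intro identity_T_Var)
next
  case (insert m X)
  define I0 where "I0 = {l \<in> I. SVar m \<notin> set l}"
  define I1 where "I1 = {l \<in> I. SVar m \<in> set l}"
  have fin: "finite I0" "finite I1"
    using insert.prems(1) by (simp_all add: I0_def I1_def)
  have split: "(\<Sum>l\<in>I. h l) = (\<Sum>l\<in>I0. h l) + (\<Sum>l\<in>I1. h l)" for h :: "letter list \<Rightarrow> 'c::comm_monoid_add"
  proof -
    have "I = I0 \<union> I1" "I0 \<inter> I1 = {}"
      by (auto simp: I0_def I1_def)
    then show ?thesis
      using fin by (simp add: sum.union_disjoint)
  qed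
  let ?f0 = "\<Sum>l\<in>I0. fscale (c l) (yzw l)"
  let ?f1 = "\<Sum>l\<in>I1. fscale (c l) (yzw l)"
  have zero0: "ev x ?f0 = 0" for x
  proof -
    \<comment> \<open>Half the trace: the scalar \<open>?h\<close> in place of \<open>x m\<close>
      keeps the value of \<open>Y m\<close> and makes that of \<open>Z m\<close> zero.\<close>
    let ?h = "(e11 (x m) + e22 (x m)) / 2"
    have half: "?h + ?h = e11 (x m) + e22 (x m)"
      using two by (simp flip: mult_2)
    define x' where "x' = x(m := mk_ut2 ?h ?h 0)"
    have k: "k12 \<nu> (mk_ut2 ?h ?h 0) = 0"
      by (simp add: k12_def)
    have Zm: "ev x' (Z m) = 0"
      by (rule ut2_eqI'[of _ _ \<nu>]) (simp_all add: ev_Z x'_def k)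
    have other: "ev x' (yz a) = ev x (yz a)" if "a \<noteq> SVar m" for a
      using that half by (cases a) (auto intro!: ut2_eqI'[of _ _ \<nu>] simp: ev_Y ev_Z x'_def eps)
    have "ev x' (yzw l) = ev x (yzw l)" if "SVar m \<notin> set l" for l
      using that by (induction l) (auto simp: ev_mult other)
    moreover have "ev x' (yzw l) = 0" if "SVar m \<in> set l" for l
      using that by (induction l) (auto simp: ev_mult Zm)
    ultimately have "ev x' (\<Sum>l\<in>I. fscale (c l) (yzw l)) = ev x ?f0"
      unfolding split by (simp add: ev_add ev_sum ev_scale I0_def I1_def)
    then show ?thesis
      using insert.prems(3) by simp
  qed
  have f0: "?f0 \<in> T"
    by (rule insert.IH[OF fin(1) _ zero0]) (use insert.prems(2) I0_def in blast)
  have zero1: "ev x ?f1 = 0" for x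
    using insert.prems(3)[of x] zero0[of x] by (simp add: split ev_add)
  have "?f1 \<in> comm_span m"
    by (rule identity_comm_span[OF fin(2) _ zero1]) (simp add: I1_def)
  then have "?f1 \<in> T"
    by (intro gz_span_identity comm_span_identity zero1)
  then show ?case
    unfolding split by (rule T_ideal_add[OF f0])
qed

lemma identity_T:
  assumes "\<And>x. ev x f = 0"
  shows "f \<in> T"
proof -
  obtain I c where "finite I" "f = (\<Sum>l\<in>I. fscale (c l) (yzw l))"
    by (rule free_alg_words)
  moreover from this have "finite (\<Union>l\<in>I. SVar -` set l)"
    by (auto intro: finite_vimageI simp: inj_def)
  ultimately show ?thesis
    using assms identity_T_words[of "\<Union>l\<in>I. SVar -` set l" I c] by auto
qed

lemma central_polys_eq: "star_central_polys ut2_scale s = TS_star skew_gens"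
proof
  show "TS_star skew_gens \<subseteq> star_central_polys ut2_scale s"
  proof (rule TS_least[OF T_star_space_central])
    have "Y 0 \<in> star_central_polys ut2_scale s"
      by (simp add: central_iff ev_Y eps)
    then show "skew_gens \<subseteq> star_central_polys ut2_scale s"
      by (auto simp: skew_gens_def central_iff ev_mult ev_skew_ids)
  qed
  show "star_central_polys ut2_scale s \<subseteq> TS_star skew_gens"
  proof
    fix f :: "'a free_alg"
    assume f: "f \<in> star_central_polys ut2_scale s"
    have "f + fstar f \<in> TS_star skew_gens"
      using TS_subst[of "Y 0" skew_gens "\<lambda>_. f"] TS_superset[of skew_gens]
      by (auto simp: Y_def skew_gens_def free.ev_simps)
    \<comment> \<open>The values of \<open>f\<close> are central, hence fixed by \<open>s\<close>,
      and so equal to those of \<open>fstar f\<close>.\<close>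
    moreover have "ev x (f - fstar f) = 0" for x
      using f s(2) by (simp add: ev_diff ev_fstar star_central_polys_def first_kind_def)
    then have "f - fstar f \<in> TS_star skew_gens"
      by (intro T_ideal_subset identity_T)
    ultimately have "(f + fstar f) + (f - fstar f) \<in> TS_star skew_gens"
      by (rule free.subspace_add[OF subspace_TS])
    then show "f \<in> TS_star skew_gens"
      using halve[OF subspace_TS, of f] by simp
  qed
qed

lemma finite_skew_gens: "finite skew_gens"
  by (simp add: skew_gens_def skew_ids_def)

end

section \<open>The involution that fixes the upper right entry\<close>

locale ut2_sym = ut2_star +
  assumes eps: "\<epsilon> = 1"
begin

text \<open>A symmetric generator has a value \<open>a + c e\<close> with \<open>a\<close> scalar
  and \<open>e\<close> square-zero. Over a field with \<open>q\<close> elements its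
  \<open>q\<close>-th power is \<open>a\<close>, so \<open>gy\<close> has the value
  \<open>c e\<close>; over an infinite field \<open>gy\<close> is 0.\<close>

definition gy :: "nat \<Rightarrow> 'a free_alg"
  where "gy i = Y i - Y i ^ q"

text \<open>The guarded relation exchanges \<open>Z 2 * gy 3\<close> for a commutator. Over an
  infinite field \<open>gy\<close> is 0 while \<open>[Y 3, Z 2]\<close> is not an identity, hence
  the guard.\<close>

definition sym_ids :: "'a free_alg set"
  where "sym_ids = {comm (Y 2) (Y 3), comm (Z 2) (Z 3),
    Z 2 * comm (Y 3) (Z 4) + comm (Y 3) (Z 4) * Z 2,
    comm (Y 2) (comm (Y 3) (Z 4)),
    comm (Y 2) (Z 3) * comm (Y 4) (Z 5),
    Z 2 * comm (Y 3) (Z 4) - Z 4 * comm (Y 3) (Z 2),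
    Z 2 ^ q - Z 2, gy 2 * comm (Y 3) (Z 4), (Z 2 ^ (q - 1) - 1) * comm (Y 3) (Z 2),
    if finite (UNIV :: 'a set) then Z 2 * gy 3 + Z 2 * gy 3 + comm (Y 3) (Z 2) else 0,
    gy 2 * gy 3, comm (Y 2) (Z 3) * gy 4}"

text \<open>In characteristic zero the exponent \<open>CHAR('a)\<close> is 0, and the first
  generator is the constant 1.\<close>

definition sym_gens :: "'a free_alg set"
  where "sym_gens = {Y 0 ^ (if finite (UNIV :: 'a set) then CARD('a) else CHAR('a)),
      (Y 0 * Z 1 + Z 1 * Y 0) * Z 2}
    \<union> (\<lambda>r. gen (Var 0) * r * gen (Var 1)) ` sym_ids"

abbreviation T :: "'a free_alg set"
  where "T \<equiv> T_ideal sym_gens"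

lemma of_nat_q: "finite (UNIV :: 'a set) \<Longrightarrow> of_nat q = (0::'a)"
  by (simp add: q field_exp_def of_nat_CARD)

lemma ev_gy: "e11 (ev x (gy i)) = 0" "e22 (ev x (gy i)) = 0"
    "k12 \<nu> (ev x (gy i)) = (if finite (UNIV :: 'a set) then k12 \<nu> (ev x (Y i)) else 0)"
proof -
  show "e11 (ev x (gy i)) = 0" "e22 (ev x (gy i)) = 0"
    by (simp_all add: gy_def ev_simps ev_Y power_q)
  show "k12 \<nu> (ev x (gy i)) = (if finite (UNIV :: 'a set) then k12 \<nu> (ev x (Y i)) else 0)"
  proof (cases "finite (UNIV :: 'a set)")
    case False
    then have "q = 1"
      by (simp add: q field_exp_def)
    then have "ev x (Y i ^ q) = ev x (Y i)"
      by simp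
    then show ?thesis
      using False by (simp add: gy_def ev_diff)
  qed (simp add: gy_def ev_diff ev_power k12_power_sym ev_Y of_nat_q)
qed

lemma ev_comm_YZ: "e11 (ev x (comm (Y i) (Z j))) = 0" "e22 (ev x (comm (Y i) (Z j))) = 0"
    "k12 \<nu> (ev x (comm (Y i) (Z j))) = - 2 * (e11 (ev x (Z j)) * k12 \<nu> (ev x (Y i)))"
  by (simp_all add: comm_def ev_simps ev_Y ev_Z eps algebra_simps)

lemma ev_sym_ids:
  assumes "r \<in> sym_ids"
  shows "ev x r = 0"
proof -
  have e22: "e22 (ev x (Y i)) = e11 (ev x (Y i))" "e22 (ev x (Z i)) = - e11 (ev x (Z i))"
    and kZ: "k12 \<nu> (ev x (Z i)) = 0" for x i
    by (simp_all add: ev_Y ev_Z eps)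
  have "ev x (comm (Y 2) (Y 3)) = 0" "ev x (comm (Z 2) (Z 3)) = 0"
    "ev x (comm (Y 2) (comm (Y 3) (Z 4))) = 0"
    by (rule ev_zeroI; simp add: comm_def ev_simps e22 kZ algebra_simps)+
  moreover have "ev x (Z 2 ^ q - Z 2) = 0"
    by (rule ev_zeroI) (simp_all add: ev_simps e22 kZ power_q k12_power_skew odd_q)
  moreover have "ev x (Z 2 * comm (Y 3) (Z 4) + comm (Y 3) (Z 4) * Z 2) = 0"
    "ev x (comm (Y 2) (Z 3) * comm (Y 4) (Z 5)) = 0"
    "ev x (Z 2 * comm (Y 3) (Z 4) - Z 4 * comm (Y 3) (Z 2)) = 0"
    "ev x (gy 2 * comm (Y 3) (Z 4)) = 0" "ev x (gy 2 * gy 3) = 0" "ev x (comm (Y 2) (Z 3) * gy 4) = 0"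
    by (rule ev_zeroI; simp add: ev_simps ev_comm_YZ ev_gy e22 kZ; simp add: algebra_simps)+
  moreover have "ev x ((Z 2 ^ (q - 1) - 1) * comm (Y 3) (Z 2)) = 0"
    by (rule ev_zeroI; use power_q_pred(1)[of "e11 (ev _ (Z 2))"] in \<open>auto simp: ev_simps ev_comm_YZ\<close>)
  moreover have "ev x (if finite (UNIV :: 'a set) then Z 2 * gy 3 + Z 2 * gy 3 + comm (Y 3) (Z 2) else 0) = 0"
  proof (cases "finite (UNIV :: 'a set)")
    case True
    then show ?thesis
      by (simp, intro ev_zeroI) (simp_all add: ev_simps ev_comm_YZ ev_gy)
  qed simp
  ultimately show ?thesis
    using assms unfolding sym_ids_def by blast
qed

lemma sym_T:
  assumes "r \<in> sym_ids" "\<And>u v. free.ev (subst_inner u v js) r = free.ev (subst_inner 0 0 js) r"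
  shows "free.ev (subst_inner 0 0 js) r \<in> T"
  by (rule T_ideal_intro[where r = r and js = js]) (use assms ev_sym_ids in \<open>auto simp: sym_gens_def\<close>)

lemma T_identities:
  "comm (Y i) (Y j) \<in> T" "comm (Z i) (Z j) \<in> T"
  "Z i * comm (Y j) (Z k) + comm (Y j) (Z k) * Z i \<in> T"
  "comm (Y i) (comm (Y j) (Z k)) \<in> T"
  "comm (Y i) (Z j) * comm (Y k) (Z l) \<in> T"
  "Z i * comm (Y j) (Z k) - Z k * comm (Y j) (Z i) \<in> T"
  "Z i ^ q - Z i \<in> T" "gy i * comm (Y j) (Z k) \<in> T"
  "(Z i ^ (q - 1) - 1) * comm (Y j) (Z i) \<in> T"
  "finite (UNIV :: 'a set) \<Longrightarrow> Z i * gy j + Z i * gy j + comm (Y j) (Z i) \<in> T"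
  "gy i * gy j \<in> T" "comm (Y i) (Z j) * gy k \<in> T"
proof -
  have *: "\<forall>r\<in>sym_ids. (\<forall>u v. free.ev (subst_inner u v [i, j, k, l]) r = free.ev (subst_inner 0 0 [i, j, k, l]) r)
      \<longrightarrow> free.ev (subst_inner 0 0 [i, j, k, l]) r \<in> T"
    using sym_T by blast
  then show "comm (Y i) (Y j) \<in> T" "comm (Z i) (Z j) \<in> T"
    "Z i * comm (Y j) (Z k) + comm (Y j) (Z k) * Z i \<in> T"
    "comm (Y i) (comm (Y j) (Z k)) \<in> T"
    "comm (Y i) (Z j) * comm (Y k) (Z l) \<in> T"
    "Z i * comm (Y j) (Z k) - Z k * comm (Y j) (Z i) \<in> T"
    "Z i ^ q - Z i \<in> T" "gy i * comm (Y j) (Z k) \<in> T"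
    "(Z i ^ (q - 1) - 1) * comm (Y j) (Z i) \<in> T"
    "gy i * gy j \<in> T" "comm (Y i) (Z j) * gy k \<in> T"
    by (simp_all add: sym_ids_def comm_def gy_def free.ev_simps)
  show "Z i * gy j + Z i * gy j + comm (Y j) (Z i) \<in> T" if "finite (UNIV :: 'a set)"
    using * that by (simp add: sym_ids_def comm_def gy_def free.ev_simps)
qed

lemma sym_gens_central: "sym_gens \<subseteq> star_central_polys ut2_scale s"
proof -
  have char: "of_nat (if finite (UNIV :: 'a set) then CARD('a) else CHAR('a)) = (0 :: 'a)"
    by (simp add: of_nat_CARD)
  have "Y 0 ^ (if finite (UNIV :: 'a set) then CARD('a) else CHAR('a)) \<in> star_central_polys ut2_scale s"
    unfolding central_iff ev_power by (subst k12_power_sym) (simp_all only: char e_power ev_Y mult_zero_left simp_thms)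
  moreover have "(Y 0 * Z 1 + Z 1 * Y 0) * Z 2 \<in> star_central_polys ut2_scale s"
    by (simp add: central_iff ev_simps ev_Y ev_Z eps algebra_simps)
  ultimately show ?thesis
    by (auto simp: sym_gens_def central_iff ev_mult ev_sym_ids)
qed

lemma finite_sym_gens: "finite sym_gens"
  by (simp add: sym_gens_def sym_ids_def)

lemma T_comm:
  assumes "is_skew a = is_skew b"
  shows "comm (yz a) (yz b) \<in> T"
  using assms by (cases a; cases b) (simp_all add: T_identities)

text \<open>Modulo \<open>T\<close>, symmetric generators commute and skew ones anticommute with
  \<open>[Y i, Z j]\<close>; commutators of two generators of the same kind lie in
  \<open>T\<close>.\<close>

lemma sym_pass_letter:
  "\<exists>c. comm (yz a) (yz b) * yz d - fscale c (yz d * comm (yz a) (yz b)) \<in> T"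
proof -
  have YZ: "\<exists>c. comm (Y i) (Z j) * yz d - fscale c (yz d * comm (Y i) (Z j)) \<in> T" for i j
  proof (cases d)
    case (Var k)
    have "comm (Y i) (Z j) * yz d - fscale 1 (yz d * comm (Y i) (Z j)) = - comm (Y k) (comm (Y i) (Z j))"
      by (simp add: Var comm_def)
    then show ?thesis
      using T_ideal_neg[OF T_identities(4)] by metis
  next
    case (SVar k)
    have "comm (Y i) (Z j) * yz d - fscale (-1) (yz d * comm (Y i) (Z j))
        = Z k * comm (Y i) (Z j) + comm (Y i) (Z j) * Z k"
      by (simp add: SVar)
    then show ?thesis
      using T_identities(3) by metis
  qed
  show ?thesis
  proof (cases "is_skew a = is_skew b")
    case True
    then have "comm (yz a) (yz b) * yz d - fscale 0 (yz d * comm (yz a) (yz b)) \<in> T"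
      by (simp add: T_comm T_ideal_right)
    then show ?thesis ..
  next
    case False
    then consider i j where "a = Var i" "b = SVar j" | i j where "a = SVar i" "b = Var j"
      by (cases a; cases b) auto
    then show ?thesis
    proof cases
      case 1
      then show ?thesis
        using YZ by simp
    next
      case 2
      obtain c where c: "comm (Y j) (Z i) * yz d - fscale c (yz d * comm (Y j) (Z i)) \<in> T"
        using YZ by blast
      have "comm (yz a) (yz b) * yz d - fscale c (yz d * comm (yz a) (yz b))
          = - (comm (Y j) (Z i) * yz d - fscale c (yz d * comm (Y j) (Z i)))"
        by (simp add: 2 comm_swap[of "Z i"])
      then show ?thesis
        using T_ideal_neg[OF c] by metis
    qed
  qed
qed

end

sublocale ut2_sym \<subseteq> ut2_gens s \<epsilon> \<nu> q sym_gens
  by unfold_locales (rule sym_pass_letter)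

section \<open>Words with one commutator or one \<open>gy\<close>\<close>

context ut2_sym
begin

lemma nil_comm: "nil_elem (comm (Y i) (Z j))" and nil_gy: "nil_elem (gy i)"
proof -
  have "comm (yz a) (yz b) * comm (Y i) (Z j) \<in> T \<and> comm (yz a) (yz b) * gy i \<in> T" for a b
  proof (cases "is_skew a = is_skew b")
    case False
    then consider k l where "a = Var k" "b = SVar l" | k l where "a = SVar l" "b = Var k"
      by (cases a; cases b) auto
    then show ?thesis
    proof cases
      case 1
      then show ?thesis
        by (simp add: T_identities)
    next
      case 2
      then show ?thesis
        by (simp add: comm_swap[of "Z l"] T_identities T_ideal_neg)
    qed
  qed (auto simp: T_comm T_ideal_right)
  then show "nil_elem (comm (Y i) (Z j))" "nil_elem (gy i)"
    by (auto simp: nil_elem_def)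
qed

lemma power_comm: "(yz x ^ q - yz x) * comm (Y i) (Z j) \<in> T"
  and power_gy: "(yz x ^ q - yz x) * gy i \<in> T"
proof -
  have "(yz x ^ q - yz x) * comm (Y i) (Z j) \<in> T \<and> (yz x ^ q - yz x) * gy i \<in> T"
  proof (cases x)
    case (Var k)
    have "(yz x ^ q - yz x) * f = - (gy k * f)" for f
      by (simp add: Var gy_def algebra_simps)
    then show ?thesis
      by (simp add: T_ideal_neg T_identities)
  qed (simp add: T_ideal_right T_identities)
  then show "(yz x ^ q - yz x) * comm (Y i) (Z j) \<in> T" "(yz x ^ q - yz x) * gy i \<in> T"
    by auto
qed

text \<open>Skew letters in front of \<open>gy i\<close> are left out because they can be exchanged
  for commutators. The values then depend on the symmetric generators only.\<close>

definition gy_span :: "'a free_alg set"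
  where "gy_span = free.span ((\<lambda>(i, l). yzw l * gy i) ` {(i, l). zdeg (mset l) = 0} \<union> T)"

definition comm_span :: "'a free_alg set"
  where "comm_span = free.span ((\<lambda>(i, j, l). yzw l * comm (Y i) (Z j)) ` UNIV
    \<union> ((\<lambda>(i, l). yzw l * gy i) ` {(i, l). zdeg (mset l) = 0} \<union> T))"

lemma subspace_gy_span: "free.subspace gy_span"
  and subspace_comm_span: "free.subspace comm_span"
  by (simp_all add: gy_span_def comm_span_def)

lemmas comm_span_add = free.subspace_add[OF subspace_comm_span]
  and comm_span_diff = free.subspace_diff[OF subspace_comm_span]
  and comm_span_neg = free.subspace_neg[OF subspace_comm_span]
  and comm_span_scale = free.subspace_scale[OF subspace_comm_span]
  and gy_span_add = free.subspace_add[OF subspace_gy_span]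
  and gy_span_diff = free.subspace_diff[OF subspace_gy_span]

lemma T_gy_span: "f \<in> T \<Longrightarrow> f \<in> gy_span"
  by (auto simp: gy_span_def intro: free.span_base)

lemma gy_span_base: "zdeg (mset l) = 0 \<Longrightarrow> yzw l * gy i \<in> gy_span"
  unfolding gy_span_def by (rule free.span_base) force

lemma gy_span_subset: "f \<in> gy_span \<Longrightarrow> f \<in> comm_span"
  unfolding gy_span_def comm_span_def by (meson free.span_mono subsetD Un_upper2)

lemma T_comm_span: "f \<in> T \<Longrightarrow> f \<in> comm_span"
  by (simp add: T_gy_span gy_span_subset)

lemma comm_span_base: "yzw l * comm (Y i) (Z j) \<in> comm_span"
  unfolding comm_span_def by (rule free.span_base, rule UnI1, rule range_eqI[where x = "(i, j, l)"]) simp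

lemma infinite_gy:
  assumes "infinite (UNIV :: 'a set)"
  shows "gy i = 0"
proof -
  have "q = 1"
    using assms by (simp add: q field_exp_def)
  then have "Y i ^ q = (Y i :: 'a free_alg)"
    by simp
  then show ?thesis
    by (simp add: gy_def)
qed

lemma comm_span_comm: "yzw l * comm (yz a) (yz b) \<in> comm_span"
proof (cases "is_skew a = is_skew b")
  case False
  then consider i j where "a = Var i" "b = SVar j" | i j where "a = SVar j" "b = Var i"
    by (cases a; cases b) auto
  then show ?thesis
  proof cases
    case 1
    then show ?thesis
      by (simp add: comm_span_base)
  next
    case 2
    then show ?thesis
      using comm_span_neg[OF comm_span_base] by (simp add: comm_swap[of "Z j"])
  qed
qed (intro T_comm_span T_ideal_left T_comm)

text \<open>A skew letter of the word is moved next to \<open>gy i\<close>; over a finite field,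
  \<open>2 Z j gy i = - [Y i, Z j]\<close> modulo \<open>T\<close>.\<close>

lemma comm_span_gy: "yzw l * gy i \<in> comm_span"
proof (cases "zdeg (mset l) = 0")
  case True
  then show ?thesis
    by (intro gy_span_subset gy_span_base)
next
  case False
  then obtain j N where "mset l = add_mset (SVar j) N"
    using zdeg_pos_split by blast
  then have "SVar j \<in> set l"
    by (metis set_mset_mset union_single_eq_member)
  then obtain l' where l': "yzw l * gy i - yzw l' * (yz (SVar j) * gy i) \<in> T"
    using nil_letter_last[OF nil_gy] by metis
  have "yzw l' * (Z j * gy i) \<in> comm_span"
  proof (cases "finite (UNIV :: 'a set)")
    case True
    show ?thesis
    proof (rule halve[OF subspace_comm_span])
      have "yzw l' * (Z j * gy i) + yzw l' * (Z j * gy i)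
          = yzw l' * (Z j * gy i + Z j * gy i + comm (Y i) (Z j)) - yzw l' * comm (Y i) (Z j)"
        by (simp add: algebra_simps)
      also have "\<dots> \<in> comm_span"
        by (intro comm_span_diff comm_span_base T_comm_span[OF T_ideal_left] T_identities True)
      finally show "yzw l' * (Z j * gy i) + yzw l' * (Z j * gy i) \<in> comm_span" .
    qed
  qed (simp add: infinite_gy free.subspace_0[OF subspace_comm_span])
  from comm_span_add[OF T_comm_span[OF l'] this] show ?thesis
    by simp
qed

lemma comm_span_perm:
  assumes "mset l = mset l'"
  shows "yzw l - yzw l' \<in> comm_span"
proof -
  have "yzw l * 1 - yzw l' * 1 \<in> comm_span"
  proof (rule yzw_swap_mult[OF subspace_comm_span _ assms[symmetric]])
    fix u :: "letter list" and a b w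
    let ?C = "comm (yz a) (yz b)"
    obtain c where c: "?C * yzw w - fscale c (yzw w * ?C) \<in> T"
      using comm_pass by blast
    have "yzw u * (?C * (yzw w * 1)) = yzw u * (?C * yzw w - fscale c (yzw w * ?C)) + fscale c (yzw (u @ w) * ?C)"
      by (simp add: algebra_simps free.scale_mult_right)
    also have "\<dots> \<in> comm_span"
      by (intro comm_span_add comm_span_scale comm_span_comm T_comm_span[OF T_ideal_left] c)
    finally show "yzw u * (?C * (yzw w * 1)) \<in> comm_span" .
  qed simp
  then show ?thesis by simp
qed

lemma T_perm_Var:
  assumes "zdeg (mset l) = 0" "mset l = mset l'"
  shows "yzw l - yzw l' \<in> T"
proof -
  have "yzw l * 1 - yzw l' * 1 \<in> T"
  proof (rule yzw_swap_mult[OF subspace_T_ideal _ assms(2)[symmetric]])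
    fix u :: "letter list" and a b w
    assume "mset (u @ [a, b] @ w) = mset l"
    then have "zdeg (mset (u @ [a, b] @ w)) = 0"
      using assms(1) by simp
    then have "is_skew a = is_skew b"
      by (auto split: if_splits)
    then show "yzw u * (comm (yz a) (yz b) * (yzw w * 1)) \<in> T"
      by (intro T_ideal_left T_ideal_right T_comm)
  qed simp
  then show ?thesis by simp
qed

lemma gy_span_power:
  assumes "zdeg (add_mset x M) = 0"
  shows "yzw (rep (M + replicate_mset q x)) - yzw (rep (add_mset x M)) \<in> gy_span"
proof -
  obtain i where i: "x = Var i"
    using assms by (cases x) auto
  have M: "zdeg M = 0"
    using assms i by simp
  have 1: "yzw (rep (M + replicate_mset q x)) - yzw (rep M @ replicate q x) \<in> T"
    by (rule T_perm_Var) (simp_all add: M i)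
  have 2: "yzw (rep M @ [x]) - yzw (rep (add_mset x M)) \<in> T"
    by (rule T_perm_Var) (simp_all add: M i)
  have 3: "yzw (rep M) * gy i \<in> gy_span"
    by (rule gy_span_base) (simp add: M)
  have "(yzw (rep (M + replicate_mset q x)) - yzw (rep M @ replicate q x))
      - yzw (rep M) * gy i + (yzw (rep M @ [x]) - yzw (rep (add_mset x M))) \<in> gy_span"
    by (rule gy_span_add[OF gy_span_diff[OF T_gy_span[OF 1] 3] T_gy_span[OF 2]])
  then show ?thesis
    by (simp add: i gy_def algebra_simps)
qed

lemma comm_span_power:
  "yzw (rep (M + replicate_mset q x)) - yzw (rep (add_mset x M)) \<in> comm_span"
proof -
  have "yzw (rep M) * (yz x ^ q - yz x) \<in> comm_span"
  proof (cases x)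
    case (SVar i)
    then show ?thesis
      by (simp add: T_comm_span T_ideal_left T_identities)
  next
    case (Var k)
    from comm_span_neg[OF comm_span_gy[of "rep M" k]] show ?thesis
      by (simp add: Var gy_def algebra_simps)
  qed
  moreover have "yzw (rep (M + replicate_mset q x)) - yzw (rep M @ replicate q x) \<in> comm_span"
    "yzw (rep M @ [x]) - yzw (rep (add_mset x M)) \<in> comm_span"
    by (rule comm_span_perm; simp)+
  ultimately have "yzw (rep M) * (yz x ^ q - yz x) + (yzw (rep (M + replicate_mset q x)) - yzw (rep M @ replicate q x))
      + (yzw (rep M @ [x]) - yzw (rep (add_mset x M))) \<in> comm_span"
    by (intro comm_span_add)
  then show ?thesis
    by (simp add: algebra_simps)
qed

text \<open>Even words contribute equally to both diagonal entries and odd words with opposite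
  signs, so for a central value the odd part vanishes on the diagonal. As \<open>q\<close> is odd,
  reducing exponents preserves parity.\<close>

lemma odd_words:
  assumes "finite I" and central: "(\<Sum>l\<in>I. fscale (c l) (yzw l)) \<in> star_central_polys ut2_scale s"
  shows "(\<Sum>l\<in>{l \<in> I. odd (zdeg (mset l))}. fscale (c l) (yzw l)) \<in> comm_span"
proof -
  let ?J = "{l \<in> I. odd (zdeg (mset l))}"
  let ?L = "\<lambda>M. if odd (zdeg M) then yzw (rep M) else 0"
  show ?thesis
  proof (rule free.vanishing_monomial_sum[OF subspace_comm_span, where m = mset and L = ?L])
    show "finite ?J"
      using assms by simp
    fix v :: "letter \<Rightarrow> 'a"
    obtain x where x: "\<And>a. e11 (ev x (yz a)) = v a"
      using assignment by blast
    have "e11 (ev x (\<Sum>l\<in>I. fscale (c l) (yzw l))) - e22 (ev x (\<Sum>l\<in>I. fscale (c l) (yzw l)))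
        = (\<Sum>l\<in>I. if odd (zdeg (mset l)) then 2 * (c l * (\<Prod>a\<in>#mset l. v a)) else 0)"
      by (induction I rule: infinite_finite_induct) (simp_all add: ev_simps e11_yzw e22_yzw x)
    also have "\<dots> = 2 * (\<Sum>l\<in>?J. c l * (\<Prod>a\<in>#mset l. v a))"
      using assms(1) by (simp add: sum_distrib_left sum.inter_filter if_distrib cong: if_cong)
    finally show "(\<Sum>l\<in>?J. c l * (\<Prod>a\<in>#mset l. v a)) = 0"
      using central two by (simp add: central_iff)
  next
    show "yzw l - ?L (mset l) \<in> comm_span" if "l \<in> ?J" for l
      using that comm_span_perm[of l "rep (mset l)"] by simp
    show "?L (M + replicate_mset (field_exp TYPE('a)) x) - ?L (add_mset x M) \<in> comm_span" for M x
      using comm_span_power[of M x] odd_q free.subspace_0[OF subspace_comm_span]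
      unfolding q[symmetric] by auto
  qed
qed

text \<open>Splitting off two skew letters leaves a word \<open>w\<close> of even skew degree. With
  \<open>y\<close> the sum of \<open>w\<close> and its reverse, all four words in
  \<open>(y z + z y) z'\<close> are rearrangements of the given one; so this instance of a generator
  is four times the word, up to \<open>comm_span\<close>.\<close>

lemma even_word:
  assumes "even (zdeg (mset l))" "zdeg (mset l) > 0"
  shows "yzw l \<in> free.span (TS_star sym_gens \<union> comm_span)"
proof -
  let ?U = "free.span (TS_star sym_gens \<union> comm_span)"
  obtain i N where i: "mset l = add_mset (SVar i) N"
    using zdeg_pos_split assms(2) by blast
  with assms have "odd (zdeg N)"
    by simp
  then have "zdeg N > 0"
    by (cases "zdeg N") auto
  then obtain j N' where j: "N = add_mset (SVar j) N'"
    using zdeg_pos_split by blast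
  obtain w where w: "mset w = N'"
    using ex_mset by blast
  have even: "even (zdeg (mset w))"
    using assms(1) by (simp add: i j w)
  let ?y = "yzw w + yzw (rev w) :: 'a free_alg"
  let ?f = "(?y * Z i + Z i * ?y) * Z j"
  have half: "fscale (1 / 2) f + fscale (1 / 2) f = f" for f :: "'a free_alg"
    using two by (simp flip: free.scale_left_distrib add: field_simps)
  \<comment> \<open>As \<open>w\<close> has even skew degree, \<open>?y\<close> is symmetric; half
    of it, put for the first variable, turns \<open>Y 0\<close> into \<open>?y\<close>.\<close>
  have y: "fscale (1 / 2) ?y + fscale (1 / 2) (fstar ?y) = ?y"
    using half[of ?y] even by (simp add: fstar_add fstar_yzw add.commute)
  have "?f \<in> TS_star sym_gens"
    using TS_subst[of "(Y 0 * Z 1 + Z 1 * Y 0) * Z 2" sym_gens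
        "\<lambda>k. if k = 0 then fscale (1 / 2) ?y else if k = 1 then gen (Var i) else gen (Var j)"] TS_superset[of sym_gens]
    by (simp add: sym_gens_def Y_def Z_def free.ev_simps fstar_gen fstar_scale y)
  then have f: "?f \<in> ?U"
    by (intro free.span_base) simp
  let ?l1 = "w @ [SVar i, SVar j]"
  let ?l2 = "rev w @ [SVar i, SVar j]"
  let ?l3 = "SVar i # w @ [SVar j]"
  let ?l4 = "SVar i # rev w @ [SVar j]"
  have perm: "yzw l - yzw l' \<in> ?U" if "mset l' = mset l" for l'
    using comm_span_perm[of l l'] that by (intro free.span_base) simp
  have "yzw l - yzw ?l1 \<in> ?U" "yzw l - yzw ?l2 \<in> ?U" "yzw l - yzw ?l3 \<in> ?U" "yzw l - yzw ?l4 \<in> ?U"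
    by (rule perm; simp add: i j w)+
  then have "(yzw l - yzw ?l1) + (yzw l - yzw ?l2) + ((yzw l - yzw ?l3) + (yzw l - yzw ?l4)) + ?f \<in> ?U"
    using f by (intro free.span_add)
  moreover have "(yzw l - yzw ?l1) + (yzw l - yzw ?l2) + ((yzw l - yzw ?l3) + (yzw l - yzw ?l4)) + ?f
      = (yzw l + yzw l) + (yzw l + yzw l)"
    by (simp add: algebra_simps)
  ultimately show ?thesis
    using halve[OF free.subspace_span] by (metis (no_types, lifting))
qed

section \<open>Separating the commutators from the words without skew letters\<close>

definition Y_span :: "'a free_alg set"
  where "Y_span = free.span (yzw ` {l. zdeg (mset l) = 0} \<union> T)"

lemma Y_span_word: "zdeg (mset l) = 0 \<Longrightarrow> yzw l \<in> Y_span"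
  by (auto simp: Y_span_def intro: free.span_base)

lemma subspace_Y_span: "free.subspace Y_span"
  by (simp add: Y_span_def)

lemma gy_span_Y_span: "gy_span \<subseteq> Y_span"
  unfolding gy_span_def
proof (rule free.span_minimal)
  have "yzw l * gy i \<in> Y_span" if "zdeg (mset l) = 0" for i l
  proof -
    have "yzw (l @ [Var i]) - yzw (l @ replicate q (Var i)) \<in> Y_span"
      by (intro free.subspace_diff[OF subspace_Y_span] Y_span_word) (use that in simp_all)
    then show ?thesis
      by (simp add: gy_def algebra_simps)
  qed
  then show "(\<lambda>(i, l). yzw l * gy i) ` {(i, l). zdeg (mset l) = 0} \<union> T \<subseteq> Y_span"
    by (auto simp: Y_span_def intro: free.span_base)
qed (simp add: Y_span_def)

lemma ev_Y_span:
  assumes "f \<in> Y_span" "\<And>i. ev x (Y i) = ev x' (Y i)"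
  shows "ev x f = ev x' f"
  using assms(1) unfolding Y_span_def
proof (induction rule: free.span_induct_alt)
  case (step c f g)
  have "ev x (yzw l) = ev x' (yzw l)" if "zdeg (mset l) = 0" for l
    using that
  proof (induction l)
    case (Cons a l)
    then show ?case
      by (cases a) (simp_all add: ev_mult assms(2))
  qed simp
  then have "ev x f = ev x' f"
    using step.hyps by (auto simp: T_ideal_ev)
  then show ?case
    using step by (simp add: ev_simps)
qed simp

text \<open>The identity \<open>Z k [Y i, Z j] = Z j [Y i, Z k]\<close>, after reordering in front
  of the commutators.\<close>

lemma T_comm_letter_change:
  "yzw (rep (add_mset (SVar k) M)) * comm (Y i) (Z j) - yzw (rep (add_mset (SVar j) M)) * comm (Y i) (Z k) \<in> T"
proof -
  have 1: "yzw (rep (add_mset (SVar k) M)) * comm (Y i) (Z j) - yzw (rep M @ [SVar k]) * comm (Y i) (Z j) \<in> T"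
    by (rule nil_perm[OF nil_comm]) simp
  have 2: "yzw (rep M @ [SVar j]) * comm (Y i) (Z k) - yzw (rep (add_mset (SVar j) M)) * comm (Y i) (Z k) \<in> T"
    by (rule nil_perm[OF nil_comm]) simp
  have 3: "yzw (rep M) * (Z k * comm (Y i) (Z j) - Z j * comm (Y i) (Z k)) \<in> T"
    by (rule T_ideal_left) (rule T_identities)
  from T_ideal_add[OF T_ideal_add[OF 1 3] 2] show ?thesis
    by (simp add: algebra_simps)
qed

text \<open>The value of \<open>comm_rep i M\<close> is \<open>- 2 c\<^sub>i v\<^sup>M e\<^sub>1\<^sub>2\<close>, where \<open>v\<close> lists the diagonal values of the
  generators, so modulo \<open>T\<close> the choice of \<open>j\<close> is immaterial.\<close>

definition comm_rep :: "nat \<Rightarrow> letter multiset \<Rightarrow> 'a free_alg"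
  where "comm_rep i M = (if zdeg M = 0 then 0 else
    let j = (SOME j. SVar j \<in># M) in yzw (rep (M - {#SVar j#})) * comm (Y i) (Z j))"

lemma comm_rep: "yzw (rep M) * comm (Y i) (Z j) - comm_rep i (add_mset (SVar j) M) \<in> T"
proof -
  define k where "k = (SOME k. SVar k \<in># add_mset (SVar j) M)"
  have k: "SVar k \<in># add_mset (SVar j) M"
    unfolding k_def by (rule someI[of _ j]) simp
  have rep: "comm_rep i (add_mset (SVar j) M) = yzw (rep (add_mset (SVar j) M - {#SVar k#})) * comm (Y i) (Z k)"
    by (simp add: comm_rep_def Let_def k_def)
  show ?thesis
  proof (cases "k = j")
    case True
    then show ?thesis
      by (simp add: rep T_ideal_0)
  next
    case False
    then obtain N where N: "M = add_mset (SVar k) N"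
      using k by (auto dest: multi_member_split)
    have "add_mset (SVar j) M - {#SVar k#} = add_mset (SVar j) N"
      by (simp add: N add_mset_commute[of "SVar j"])
    then show ?thesis
      using T_comm_letter_change[of k N i j] by (simp only: rep) (simp only: N)
  qed
qed

text \<open>If \<open>M\<close> has no skew letter and \<open>x\<close> is \<open>Z j\<close>, then
  \<open>Z j ^ (q - 1)\<close> is removed in front of \<open>[Y i, Z j]\<close>. Otherwise a skew
  letter of \<open>M\<close> is put into the commutator and the power is reduced in front of
  it.\<close>

lemma comm_rep_power: "comm_rep i (M + replicate_mset q x) - comm_rep i (add_mset x M) \<in> T"
proof (cases "zdeg (add_mset x M) = 0")
  case True
  then show ?thesis
    by (auto simp: comm_rep_def T_ideal_0 split: if_splits)
next
  case False
  show ?thesis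
  proof (cases "zdeg M = 0")
    case True
    then obtain j where x: "x = SVar j"
      using False by (cases x) auto
    have 1: "yzw (rep (M + replicate_mset (q - 1) x)) * comm (Y i) (Z j) - comm_rep i (M + replicate_mset q x) \<in> T"
      using comm_rep[of "M + replicate_mset (q - 1) x" i j] q_pos by (cases q) (simp_all add: x)
    have 2: "yzw (rep M) * comm (Y i) (Z j) - comm_rep i (add_mset x M) \<in> T"
      using comm_rep[of M i j] by (simp add: x)
    have 3: "yzw (rep (M + replicate_mset (q - 1) x)) * comm (Y i) (Z j)
        - yzw (rep M @ replicate (q - 1) x) * comm (Y i) (Z j) \<in> T"
      by (rule nil_perm[OF nil_comm]) simp
    have 4: "yzw (rep M) * ((Z j ^ (q - 1) - 1) * comm (Y i) (Z j)) \<in> T"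
      by (rule T_ideal_left) (rule T_identities)
    from T_ideal_add[OF T_ideal_diff[OF 2 1] T_ideal_add[OF 3 4]] show ?thesis
      by (simp add: x algebra_simps)
  next
    case False
    then obtain j N where N: "M = add_mset (SVar j) N"
      using zdeg_pos_split by blast
    have 1: "yzw (rep (N + replicate_mset q x)) * comm (Y i) (Z j) - comm_rep i (M + replicate_mset q x) \<in> T"
      using comm_rep[of "N + replicate_mset q x" i j] by (simp add: N)
    have 2: "yzw (rep (add_mset x N)) * comm (Y i) (Z j) - comm_rep i (add_mset x M) \<in> T"
      using comm_rep[of "add_mset x N" i j] by (simp add: N add_mset_commute)
    have 3: "yzw (rep (N + replicate_mset q x)) * comm (Y i) (Z j) - yzw (rep (add_mset x N)) * comm (Y i) (Z j) \<in> T"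
      by (rule nil_power[OF nil_comm power_comm])
    from T_ideal_add[OF T_ideal_diff[OF 2 1] 3] show ?thesis
      by (simp add: algebra_simps)
  qed
qed

text \<open>Off-diagonal value 1 for \<open>Y i\<close> and 0 for the other symmetric generators
  isolates the commutators containing \<open>Y i\<close>; their monomials include the skew letter of
  the commutator.\<close>

lemma comm_words_identity:
  assumes "finite I" and g: "g = (\<Sum>p\<in>I. fscale (c p) (case p of (i, j, l) \<Rightarrow> yzw l * comm (Y i) (Z j)))"
    and zero: "\<And>x. k12 \<nu> (ev x g) = 0"
  shows "g \<in> T"
proof -
  let ?h = "\<lambda>(i, j, l). yzw l * comm (Y i) (Z j)"
  let ?m = "\<lambda>(i, j, l). add_mset (SVar j) (mset l)"
  have part: "(\<Sum>p\<in>{p \<in> I. fst p = i}. fscale (c p) (?h p)) \<in> T" for i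
  proof (rule free.vanishing_monomial_sum[OF subspace_T_ideal, where m = ?m and L = "comm_rep i"])
    let ?J = "{p \<in> I. fst p = i}"
    show "finite ?J"
      using assms by simp
    show "comm_rep i (M + replicate_mset (field_exp TYPE('a)) x) - comm_rep i (add_mset x M) \<in> T" for M x
      using comm_rep_power by (simp add: q)
    show "?h p - comm_rep i (?m p) \<in> T" if "p \<in> ?J" for p
    proof -
      obtain i' j l where "p = (i', j, l)"
        by (cases p)
      with that have p: "p = (i, j, l)"
        by simp
      have "yzw l * comm (Y i) (Z j) - yzw (rep (mset l)) * comm (Y i) (Z j) \<in> T"
        by (rule nil_perm[OF nil_comm]) simp
      from T_ideal_add[OF this comm_rep[of "mset l" i j]] show ?thesis
        by (simp add: p)
    qed
    fix v :: "letter \<Rightarrow> 'a"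
    obtain x where x: "\<And>a. e11 (ev x (yz a)) = v a" "\<And>k. k12 \<nu> (x k) = (if k = i then 1 else 0) / 2"
      using assignment[of v "\<lambda>k. if k = i then 1 else 0"] by blast
    have kY: "k12 \<nu> (ev x (Y k)) = (if k = i then 1 else 0)" for k
      using two by (simp add: ev_Y x eps)
    have vZ: "e11 (ev x (Z k)) = v (SVar k)" for k
      using x(1)[of "SVar k"] by simp
    have "k12 \<nu> (ev x (?h p)) = (if fst p = i then - 2 * (\<Prod>a\<in>#?m p. v a) else 0)" for p
      by (cases p) (simp add: ev_mult ev_comm_YZ kY vZ e11_yzw x)
    then have "k12 \<nu> (ev x g) = (\<Sum>p\<in>I. c p * (if fst p = i then - 2 * (\<Prod>a\<in>#?m p. v a) else 0))"
      unfolding g by (induction I rule: infinite_finite_induct) (simp_all add: ev_simps)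
    also have "\<dots> = - 2 * (\<Sum>p\<in>?J. c p * (\<Prod>a\<in>#?m p. v a))"
      using assms(1) by (simp add: sum_distrib_left sum.inter_filter mult.left_commute if_distrib sum_negf cong: if_cong)
    finally show "(\<Sum>p\<in>?J. c p * (\<Prod>a\<in>#?m p. v a)) = 0"
      using zero[of x] two by simp
  qed
  have "(\<Sum>i\<in>fst ` I. \<Sum>p\<in>{p \<in> I. fst p = i}. fscale (c p) (?h p)) \<in> T"
    by (rule T_ideal_sum) (rule part)
  then show ?thesis
    unfolding g by (subst sum.image_gen[OF \<open>finite I\<close>])
qed

text \<open>Setting all skew generators to zero separates the part without skew generators from the
  commutators.\<close>

lemma comm_span_central:
  assumes f0: "f0 \<in> Y_span" and e: "e \<in> comm_span" and zero: "\<And>x. k12 \<nu> (ev x (f0 + e)) = 0"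
  obtains h where "h \<in> gy_span" "e - h \<in> T"
proof -
  let ?h = "\<lambda>(i, j, l). yzw l * comm (Y i) (Z j)"
  obtain g h where g: "g \<in> free.span (range ?h)" and h: "h \<in> gy_span" and e: "e = g + h"
    using e unfolding comm_span_def gy_span_def free.span_Un[of "range ?h"] by blast
  obtain I c where I: "finite I" "g = (\<Sum>p\<in>I. fscale (c p) (?h p))"
    using free.span_image_finite_sum[OF g] by blast
  have Y_span: "f0 + h \<in> Y_span"
    using f0 h gy_span_Y_span by (auto simp: Y_span_def intro: free.span_add)
  have "k12 \<nu> (ev x g) = 0" for x
  proof -
    \<comment> \<open>The point \<open>x'\<close> has the same values of the symmetric generators as
      \<open>x\<close>, and diagonal value 0 at the skew ones. So \<open>f0 + h\<close> keeps its
      value while \<open>g\<close> loses its off-diagonal part; the halving undoes the factor 2 in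
      \<open>ev_Y\<close>.\<close>
    obtain x' where x': "\<And>a. e11 (ev x' (yz a)) = (if is_skew a then 0 else e11 (ev x (yz a)))"
      "\<And>i. k12 \<nu> (x' i) = k12 \<nu> (ev x (Y i)) / 2"
      using assignment[of "\<lambda>a. if is_skew a then 0 else e11 (ev x (yz a))" "\<lambda>i. k12 \<nu> (ev x (Y i))"] by blast
    have "ev x (Y i) = ev x' (Y i)" for i
    proof (rule ut2_eqI'[of _ _ \<nu>])
      show "e11 (ev x (Y i)) = e11 (ev x' (Y i))"
        using x'(1)[of "Var i"] by simp
      then show "e22 (ev x (Y i)) = e22 (ev x' (Y i))"
        by (simp add: ev_Y)
      show "k12 \<nu> (ev x (Y i)) = k12 \<nu> (ev x' (Y i))"
        using two ev_Y(3)[of x' i] by (simp add: x'(2) eps)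
    qed
    then have same: "ev x (f0 + h) = ev x' (f0 + h)"
      by (rule ev_Y_span[OF Y_span])
    have "k12 \<nu> (ev x' (?h p)) = 0" for p
      using x'(1)[of "SVar _"] by (cases p) (simp add: ev_mult ev_comm_YZ)
    then have "k12 \<nu> (ev x' g) = 0"
      unfolding I(2) by (induction I rule: infinite_finite_induct) (simp_all add: ev_simps)
    moreover have "k12 \<nu> (ev z (f0 + h)) + k12 \<nu> (ev z g) = 0" for z
      using zero[of z] by (simp add: e ev_add algebra_simps)
    from this[of x] this[of x'] have "k12 \<nu> (ev x g) = k12 \<nu> (ev x' g)"
      unfolding same by (metis add_left_cancel)
    ultimately show ?thesis
      by simp
  qed
  then have "g \<in> T"
    by (rule comm_words_identity[OF I])
  then show ?thesis
    using that[OF h] by (simp add: e)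
qed

text \<open>Over a finite field, off-diagonal value 1 for \<open>Y i\<close> and 0 for the other
  symmetric generators isolates the words ending in \<open>gy i\<close>; over an infinite field
  every \<open>gy i\<close> is 0.\<close>

lemma gy_span_identity:
  assumes f: "f \<in> gy_span" and zero: "\<And>x. k12 \<nu> (ev x f) = 0"
  shows "f \<in> T"
proof -
  let ?h = "\<lambda>(i, l). yzw l * gy i"
  obtain g h where g: "g \<in> free.span (?h ` {(i, l). zdeg (mset l) = 0})" and h: "h \<in> T" and fgh: "f = g + h"
    using f unfolding gy_span_def free.span_Un free.span_eq_iff[THEN iffD2, OF subspace_T_ideal] by blast
  obtain I c where I: "finite I" "g = (\<Sum>p\<in>I. fscale (c p) (?h p))"
    using free.span_image_finite_sum[OF g] by blast
  have part: "(\<Sum>p\<in>{p \<in> I. fst p = i}. fscale (c p) (?h p)) \<in> T" for i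
  proof (cases "finite (UNIV :: 'a set)")
    case False
    then show ?thesis
      by (intro T_ideal_sum T_ideal_scale) (auto simp: infinite_gy T_ideal_0)
  next
    case True
    let ?J = "{p \<in> I. fst p = i}"
    show ?thesis
    proof (rule free.vanishing_monomial_sum[OF subspace_T_ideal,
          where m = "\<lambda>p. mset (snd p)" and L = "\<lambda>M. yzw (rep M) * gy i"])
      show "finite ?J"
        using I by simp
      show "yzw (rep (M + replicate_mset (field_exp TYPE('a)) x)) * gy i - yzw (rep (add_mset x M)) * gy i \<in> T" for M x
        using nil_power[OF nil_gy power_gy] by (simp add: q)
      show "?h p - yzw (rep (mset (snd p))) * gy i \<in> T" if "p \<in> ?J" for p
        using that nil_perm[OF nil_gy, of "snd p" "rep (mset (snd p))" i] by (cases p) simp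
      fix v :: "letter \<Rightarrow> 'a"
      obtain x where x: "\<And>a. e11 (ev x (yz a)) = v a" "\<And>k. k12 \<nu> (x k) = (if k = i then 1 else 0) / 2"
        using assignment[of v "\<lambda>k. if k = i then 1 else 0"] by blast
      have kY: "k12 \<nu> (ev x (Y k)) = (if k = i then 1 else 0)" for k
        using two by (simp add: ev_Y x eps)
      have "k12 \<nu> (ev x (?h p)) = (if fst p = i then \<Prod>a\<in>#mset (snd p). v a else 0)" for p
        using True by (cases p) (simp add: ev_mult ev_gy kY e11_yzw x)
      then have "k12 \<nu> (ev x g) = (\<Sum>p\<in>I. c p * (if fst p = i then \<Prod>a\<in>#mset (snd p). v a else 0))"
        unfolding I(2) by (induction I rule: infinite_finite_induct) (simp_all add: ev_simps)
      also have "\<dots> = (\<Sum>p\<in>?J. c p * (\<Prod>a\<in>#mset (snd p). v a))"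
        using I(1) by (simp add: sum.inter_filter if_distrib cong: if_cong)
      finally show "(\<Sum>p\<in>?J. c p * (\<Prod>a\<in>#mset (snd p). v a)) = 0"
        using zero[of x] by (simp add: fgh ev_add T_ideal_ev[OF h])
    qed
  qed
  have "(\<Sum>i\<in>fst ` I. \<Sum>p\<in>{p \<in> I. fst p = i}. fscale (c p) (?h p)) \<in> T"
    by (rule T_ideal_sum) (rule part)
  then have "g \<in> T"
    unfolding I(2) by (subst sum.image_gen[OF \<open>finite I\<close>])
  then show ?thesis
    unfolding fgh using h by (rule T_ideal_add)
qed

section \<open>Central polynomials without skew letters\<close>

lemma TS_add: "f \<in> TS_star sym_gens \<Longrightarrow> g \<in> TS_star sym_gens \<Longrightarrow> f + g \<in> TS_star sym_gens"
  by (rule free.subspace_add[OF subspace_TS])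

text \<open>The mean \<open>y\<close> of the word and its reverse is symmetric, so its power is an
  instance of a generator; \<open>y\<close> is congruent to the word modulo the ideal
  \<open>T\<close>, and so are the powers.\<close>

lemma TS_power:
  assumes "zdeg (mset l) = 0"
  shows "yzw l ^ (if finite (UNIV :: 'a set) then CARD('a) else CHAR('a)) \<in> TS_star sym_gens"
proof -
  let ?n = "if finite (UNIV :: 'a set) then CARD('a) else CHAR('a)"
  define y :: "'a free_alg" where "y = fscale (1 / 2) (yzw l + yzw (rev l))"
  have half: "fscale (1 / 2) f + fscale (1 / 2) f = f" for f :: "'a free_alg"
    using two by (simp flip: free.scale_left_distrib add: field_simps)
  have "fstar y = y"
    using assms by (simp add: y_def fstar_scale fstar_add fstar_yzw add.commute)
  have y: "(fscale (1 / 2) y + fstar (fscale (1 / 2) y)) = y"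
    using half[of y] \<open>fstar y = y\<close> by (simp add: fstar_scale)
  have "Y 0 ^ ?n \<in> TS_star sym_gens"
    using TS_superset[of sym_gens] by (simp add: sym_gens_def)
  then have "free.ev (\<lambda>_. fscale (1 / 2) y) (Y 0 ^ ?n) \<in> TS_star sym_gens"
    by (rule TS_subst)
  then have 1: "y ^ ?n \<in> TS_star sym_gens"
    by (simp only: free.ev_power) (simp only: Y_def free.ev_add free.ev_gen y)
  have "y - yzw l = fscale (1 / 2) (yzw (rev l) - yzw l)"
    using half[of "yzw l"] by (simp add: y_def free.scale_right_distrib free.scale_right_diff_distrib algebra_simps)
  also have "\<dots> \<in> T"
    by (intro T_ideal_scale T_perm_Var) (use assms in simp_all)
  finally have "y ^ ?n - yzw l ^ ?n \<in> T"
    by (rule power_diff_cong[where U = T, rotated -1]) (simp_all only: T_ideal_add T_ideal_left T_ideal_right T_ideal_0)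
  then have "y ^ ?n - yzw l ^ ?n \<in> TS_star sym_gens"
    by (rule T_ideal_subset)
  from free.subspace_diff[OF subspace_TS 1 this] show ?thesis
    by simp
qed

text \<open>Raising each letter to the \<open>q\<close>-th power changes the word by an element of
  \<open>gy_span\<close>, and the result is a rearranged \<open>q\<close>-th power of the
  word.\<close>

lemma finite_field_word:
  assumes "finite (UNIV :: 'a set)" "zdeg (mset l) = 0"
  obtains g where "g \<in> TS_star sym_gens" "yzw l - g \<in> gy_span"
proof -
  have power: "yzw (rep (N + repeat_mset q M)) - yzw (rep (N + M)) \<in> gy_span"
    if "zdeg N = 0" "zdeg M = 0" for N M
    using that
  proof (induction M arbitrary: N)
    case empty
    then show ?case
      by (simp add: free.subspace_0[OF subspace_gy_span])
  next
    case (add x M)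
    have x: "\<not> is_skew x" "zdeg M = 0"
      using add.prems by (auto split: if_splits)
    have eq: "N + repeat_mset q (add_mset x M) = (N + replicate_mset q x) + repeat_mset q M"
      "(N + replicate_mset q x) + M = (N + M) + replicate_mset q x" "N + add_mset x M = add_mset x (N + M)"
      by (simp_all add: multiset_eq_iff)
    have "yzw (rep ((N + replicate_mset q x) + repeat_mset q M)) - yzw (rep ((N + replicate_mset q x) + M)) \<in> gy_span"
      by (rule add.IH) (use add.prems x in simp_all)
    moreover have "yzw (rep ((N + M) + replicate_mset q x)) - yzw (rep (add_mset x (N + M))) \<in> gy_span"
      by (rule gy_span_power) (use add.prems x in simp)
    ultimately show ?case
      unfolding eq by (rule gy_span_add[THEN back_subst[of "\<lambda>f. f \<in> gy_span"]]) (simp add: algebra_simps)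
  qed
  have 1: "yzw (rep (repeat_mset q (mset l))) - yzw (rep (mset l)) \<in> gy_span"
    using power[of "{#}" "mset l"] assms(2) by simp
  have "zdeg (mset (concat (replicate q l))) = 0"
    using assms(2) by (auto simp: zdeg_eq_0_iff)
  then have "yzw (concat (replicate q l)) - yzw (rep (repeat_mset q (mset l))) \<in> T"
    by (rule T_perm_Var) (simp add: mset_concat_replicate)
  then have 2: "yzw l ^ q - yzw (rep (repeat_mset q (mset l))) \<in> gy_span"
    by (simp add: yzw_concat_replicate T_gy_span)
  have 3: "yzw l - yzw (rep (mset l)) \<in> gy_span"
    by (rule T_gy_span, rule T_perm_Var) (use assms in simp_all)
  have "yzw l - yzw l ^ q \<in> gy_span"
    using gy_span_diff[OF 3 gy_span_add[OF 1 2]] by simp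
  moreover have "yzw l ^ q \<in> TS_star sym_gens"
    using TS_power[OF assms(2)] assms(1) by (simp add: q field_exp_def)
  ultimately show ?thesis
    using that by blast
qed

text \<open>The Leibniz rule for the partial derivative with respect to \<open>Var i\<close>. For a
  word without this letter the factor \<open>count\<close> is 0, so nothing depends on the void
  removal.\<close>

lemma k12_yzw:
  assumes "zdeg (mset l) = 0" "\<And>a. e11 (ev x (yz a)) = v a"
    and "\<And>j. k12 \<nu> (ev x (Y j)) = (if j = i then 1 else 0)"
  shows "k12 \<nu> (ev x (yzw l)) = of_nat (count (mset l) (Var i)) * (\<Prod>a\<in>#mset l - {#Var i#}. v a)"
  using assms(1)
proof (induction l)
  case (Cons a l)
  then obtain j where a: "a = Var j" and l: "zdeg (mset l) = 0"
    by (cases a) auto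
  have e22: "e22 (ev x (yzw l)) = (\<Prod>a\<in>#mset l. v a)"
    using l by (simp add: e22_yzw assms(2))
  have vY: "e11 (ev x (Y j)) = v (Var j)"
    using assms(2)[of "Var j"] by simp
  show ?case
  proof (cases "Var i \<in># mset l")
    case True
    then obtain N where "mset l = add_mset (Var i) N"
      by (meson mset_add)
    then show ?thesis
      using Cons.IH l by (auto simp: a ev_mult assms(3) e22 vY algebra_simps add_mset_commute)
  next
    case False
    then have count: "count (mset l) (Var i) = 0"
      by (simp only: not_in_iff)
    show ?thesis
      using Cons.IH l False by (auto simp: a ev_mult assms(3) e22 vY count)
  qed
qed simp

text \<open>The coefficient of \<open>c\<^sub>i\<close> in the value is the partial derivative with respect to the \<open>i\<close>-th
  symmetric generator, so a word survives only if the characteristic divides all its exponents.\<close>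

lemma infinite_field_words:
  assumes inf: "infinite (UNIV :: 'a set)" and "finite I" and deg: "\<And>l. l \<in> I \<Longrightarrow> zdeg (mset l) = 0"
    and zero: "\<And>x. k12 \<nu> (ev x (\<Sum>l\<in>I. fscale (c l) (yzw l))) = 0"
  shows "(\<Sum>l\<in>I. fscale (c l) (yzw l)) \<in> TS_star sym_gens"
proof -
  let ?n = "\<lambda>i M. of_nat (count M (Var i)) :: 'a"
  \<comment> \<open>A word may have several nonzero partial derivatives; fixing one index for each
    monomial splits such words into disjoint classes.\<close>
  define pick where "pick M = (SOME i. ?n i M \<noteq> 0)" for M
  define G where "G = {l \<in> I. \<forall>i. ?n i (mset l) = 0}"
  define B where "B = {l \<in> I. \<exists>i. ?n i (mset l) \<noteq> 0}"
  have pick: "?n (pick M) M \<noteq> 0" if "\<exists>i. ?n i M \<noteq> 0" for M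
    unfolding pick_def using that by (rule someI_ex)
  have q1: "q = 1"
    using inf by (simp add: q field_exp_def)
  have I: "I = G \<union> B" "G \<inter> B = {}" and fin: "finite G" "finite B"
    using \<open>finite I\<close> by (auto simp: G_def B_def)
  have "(\<Sum>l\<in>G. fscale (c l) (yzw l)) \<in> TS_star sym_gens"
  proof (intro free.subspace_sum[OF subspace_TS] free.subspace_scale[OF subspace_TS])
    fix l
    assume l: "l \<in> G"
    then have deg_l: "zdeg (mset l) = 0"
      using deg by (simp add: G_def)
    \<comment> \<open>In characteristic zero this says that no letter occurs: the word is the
      constant 1, the 0-th power of any word.\<close>
    have "CHAR('a) dvd count (mset l) a" for a
    proof (cases a)
      case (Var i)
      then show ?thesis
        using l by (simp add: G_def of_nat_eq_0_iff_char_dvd)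
    next
      case (SVar i)
      then have "a \<notin># mset l"
        using deg_l unfolding zdeg_eq_0_iff by auto
      then show ?thesis
        by (simp only: not_in_iff dvd_0_right)
    qed
    then obtain M where M: "mset l = repeat_mset CHAR('a) M" "set_mset M \<subseteq> set_mset (mset l)"
      by (rule repeat_mset_dvd)
    have "zdeg (mset (rep M)) = 0"
      using deg_l M(2) by (auto simp: zdeg_eq_0_iff)
    then have "yzw (rep M) ^ CHAR('a) \<in> TS_star sym_gens"
      using TS_power[of "rep M"] inf by simp
    moreover have "yzw l - yzw (concat (replicate CHAR('a) (rep M))) \<in> T"
      by (rule T_perm_Var[OF deg_l]) (simp add: M(1) mset_concat_replicate)
    then have "yzw l - yzw (rep M) ^ CHAR('a) \<in> TS_star sym_gens"
      by (simp add: yzw_concat_replicate T_ideal_subset)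
    ultimately have "yzw (rep M) ^ CHAR('a) + (yzw l - yzw (rep M) ^ CHAR('a)) \<in> TS_star sym_gens"
      by (rule TS_add)
    then show "yzw l \<in> TS_star sym_gens"
      by simp
  qed
  moreover have "(\<Sum>l\<in>B. fscale (c l) (yzw l)) \<in> T"
  proof -
    have part: "(\<Sum>l\<in>{l \<in> B. pick (mset l) = i}. fscale (c l) (yzw (rep (mset l)))) \<in> T" for i
    proof -
      \<comment> \<open>Antidifferentiation: adding \<open>Var i\<close> and dividing by its
        exponent recovers a word of class \<open>i\<close> from its derivative. Other classes are
        sent to 0.\<close>
      let ?L = "\<lambda>N. if ?n i (add_mset (Var i) N) \<noteq> 0 \<and> pick (add_mset (Var i) N) = i
        then fscale (1 / ?n i (add_mset (Var i) N)) (yzw (rep (add_mset (Var i) N))) else 0"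
      let ?m = "\<lambda>l. mset l - {#Var i#}"
      have "(\<Sum>l\<in>I. fscale (c l * ?n i (mset l)) (?L (?m l))) \<in> T"
      proof (rule free.vanishing_monomial_sum[OF subspace_T_ideal \<open>finite I\<close>, where m = ?m and L = ?L])
        fix v :: "letter \<Rightarrow> 'a"
        obtain x where x: "\<And>a. e11 (ev x (yz a)) = v a" "\<And>k. k12 \<nu> (x k) = (if k = i then 1 else 0) / 2"
          using assignment[of v "\<lambda>k. if k = i then 1 else 0"] by blast
        have kY: "k12 \<nu> (ev x (Y k)) = (if k = i then 1 else 0)" for k
          using two by (simp add: ev_Y x eps)
        have "(\<Sum>l\<in>I. c l * ?n i (mset l) * (\<Prod>a\<in>#?m l. v a)) = (\<Sum>l\<in>I. c l * k12 \<nu> (ev x (yzw l)))"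
          by (intro sum.cong refl) (simp add: k12_yzw[OF deg x(1) kY])
        also have "\<dots> = k12 \<nu> (ev x (\<Sum>l\<in>I. fscale (c l) (yzw l)))"
          by (induction I rule: infinite_finite_induct) (simp_all add: ev_simps)
        finally show "(\<Sum>l\<in>I. c l * ?n i (mset l) * (\<Prod>a\<in>#?m l. v a)) = 0"
          by (simp only: zero)
      next
        have "M + replicate_mset (field_exp TYPE('a)) x = add_mset x M" for M and x :: letter
          using q1 by (simp add: q)
        then show "?L (M + replicate_mset (field_exp TYPE('a)) x) - ?L (add_mset x M) \<in> T" for M x
          by (simp only: diff_self T_ideal_0)
      qed (simp only: diff_self T_ideal_0)
      also have "(\<Sum>l\<in>I. fscale (c l * ?n i (mset l)) (?L (?m l)))
          = (\<Sum>l\<in>I. if l \<in> B \<and> pick (mset l) = i then fscale (c l) (yzw (rep (mset l))) else 0)"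
      proof (rule sum.cong)
        fix l
        assume "l \<in> I"
        show "fscale (c l * ?n i (mset l)) (?L (?m l))
          = (if l \<in> B \<and> pick (mset l) = i then fscale (c l) (yzw (rep (mset l))) else 0)"
        proof (cases "?n i (mset l) = 0")
          case True
          then have "\<not> (l \<in> B \<and> pick (mset l) = i)"
            using pick[of "mset l"] by (auto simp: B_def)
          then show ?thesis
            by (simp only: True if_False mult_zero_right free.scale_zero_left)
        next
          case False
          then have "Var i \<in># mset l"
            by (metis not_in_iff of_nat_0)
          then have "add_mset (Var i) (?m l) = mset l"
            by simp
          moreover have "l \<in> B"
            using False \<open>l \<in> I\<close> by (auto simp: B_def)
          ultimately show ?thesis
            using False by (simp only:) simp
        qed
      qed simp
      also have "\<dots> = (\<Sum>l\<in>{l \<in> B. pick (mset l) = i}. fscale (c l) (yzw (rep (mset l))))"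
        using \<open>finite I\<close> by (subst sum.inter_filter[symmetric]) (auto simp: B_def intro!: sum.cong)
      finally show ?thesis .
    qed
    have 1: "(\<Sum>l\<in>B. fscale (c l) (yzw (rep (mset l)))) \<in> T"
      by (subst sum.image_gen[OF fin(2), where g = "\<lambda>l. pick (mset l)"]) (rule T_ideal_sum, rule part)
    have 2: "(\<Sum>l\<in>B. fscale (c l) (yzw l - yzw (rep (mset l)))) \<in> T"
      by (intro T_ideal_sum T_ideal_scale T_perm_Var) (auto simp: B_def deg)
    from T_ideal_add[OF 1 2] show ?thesis
      by (simp add: free.scale_right_diff_distrib sum_subtractf)
  qed
  then have "(\<Sum>l\<in>B. fscale (c l) (yzw l)) \<in> TS_star sym_gens"
    by (rule T_ideal_subset)
  ultimately show ?thesis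
    unfolding I(1) sum.union_disjoint[OF fin I(2)] by (rule TS_add)
qed

lemma central_diff:
  assumes "f \<in> star_central_polys ut2_scale s" "g \<in> star_central_polys ut2_scale s"
  shows "f - g \<in> star_central_polys ut2_scale s"
  using assms by (simp add: central_iff ev_diff)

text \<open>Over a finite field each word lies in the T-star-space up to \<open>gy_span\<close>; the
  remainder is central with zero diagonal, hence an identity. Over an infinite field
  \<open>gy_span\<close> is contained in \<open>T\<close>, and the derivatives decide.\<close>

lemma central_no_skew:
  assumes "finite I" and deg: "\<And>l. l \<in> I \<Longrightarrow> zdeg (mset l) = 0" and h: "h \<in> gy_span"
    and central: "(\<Sum>l\<in>I. fscale (c l) (yzw l)) + h \<in> star_central_polys ut2_scale s"
  shows "(\<Sum>l\<in>I. fscale (c l) (yzw l)) + h \<in> TS_star sym_gens"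
proof (cases "finite (UNIV :: 'a set)")
  case True
  let ?U = "free.span (TS_star sym_gens \<union> gy_span)"
  have "yzw l \<in> ?U" if l: "l \<in> I" for l
  proof -
    obtain g where g: "g \<in> TS_star sym_gens" "yzw l - g \<in> gy_span"
      using finite_field_word[OF True deg[OF l]] by blast
    then have "g + (yzw l - g) \<in> ?U"
      by (intro free.span_add free.span_base) auto
    then show ?thesis
      by simp
  qed
  then have "(\<Sum>l\<in>I. fscale (c l) (yzw l)) + h \<in> ?U"
    using h by (intro free.span_add free.span_sum free.span_scale) (auto intro: free.span_base)
  then obtain g e where g: "g \<in> TS_star sym_gens" and e: "e \<in> gy_span"
    and eq: "(\<Sum>l\<in>I. fscale (c l) (yzw l)) + h = g + e"
    unfolding free.span_Un free.span_eq_iff[THEN iffD2, OF subspace_TS]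
      free.span_eq_iff[THEN iffD2, OF subspace_gy_span] by blast
  have "(g + e) - g \<in> star_central_polys ut2_scale s"
    using central g TS_least[OF T_star_space_central sym_gens_central] unfolding eq
    by (intro central_diff) auto
  then have "e \<in> T"
    by (intro gy_span_identity[OF e]) (simp add: central_iff)
  then show ?thesis
    unfolding eq by (rule TS_add[OF g T_ideal_subset])
next
  case False
  have "gy_span \<subseteq> T"
    unfolding gy_span_def
    by (rule free.span_minimal[OF _ subspace_T_ideal]) (auto simp: infinite_gy[OF False] T_ideal_0)
  then have "h \<in> T"
    using h by blast
  then have "k12 \<nu> (ev x (\<Sum>l\<in>I. fscale (c l) (yzw l))) = 0" for x
    using central by (simp add: central_iff ev_add T_ideal_ev)
  then have "(\<Sum>l\<in>I. fscale (c l) (yzw l)) \<in> TS_star sym_gens"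
    using infinite_field_words[OF False \<open>finite I\<close> deg] by blast
  then show ?thesis
    by (rule TS_add[OF _ T_ideal_subset[OF \<open>h \<in> T\<close>]])
qed

lemma central_polys_eq: "star_central_polys ut2_scale s = TS_star sym_gens"
proof
  show sub: "TS_star sym_gens \<subseteq> star_central_polys ut2_scale s"
    by (rule TS_least[OF T_star_space_central sym_gens_central])
  show "star_central_polys ut2_scale s \<subseteq> TS_star sym_gens"
  proof
    fix f :: "'a free_alg"
    assume f: "f \<in> star_central_polys ut2_scale s"
    obtain I c where I: "finite I" "f = (\<Sum>l\<in>I. fscale (c l) (yzw l))"
      by (rule free_alg_words)
    let ?h = "\<lambda>l. fscale (c l) (yzw l) :: 'a free_alg"
    define I0 where "I0 = {l \<in> I. zdeg (mset l) = 0}"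
    define I1 where "I1 = {l \<in> I. odd (zdeg (mset l))}"
    define I2 where "I2 = {l \<in> I. even (zdeg (mset l)) \<and> zdeg (mset l) > 0}"
    have "I = I0 \<union> (I1 \<union> I2)" "I0 \<inter> (I1 \<union> I2) = {}" "I1 \<inter> I2 = {}"
      by (auto simp: I0_def I1_def I2_def)
    moreover have fin: "finite I0" "finite I1" "finite I2"
      using I(1) by (simp_all add: I0_def I1_def I2_def)
    ultimately have split: "f = sum ?h I0 + (sum ?h I1 + sum ?h I2)"
      unfolding I(2) by (simp add: sum.union_disjoint)
    let ?U = "free.span (TS_star sym_gens \<union> comm_span)"
    have "sum ?h I1 \<in> comm_span"
      unfolding I1_def using odd_words[OF I(1)] f I(2) by simp
    then have "sum ?h I1 \<in> ?U"
      by (intro free.span_base) simp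
    moreover have "sum ?h I2 \<in> ?U"
      by (intro free.span_sum free.span_scale even_word) (simp_all add: I2_def)
    ultimately have "sum ?h I1 + sum ?h I2 \<in> ?U"
      by (rule free.span_add)
    then obtain g e where g: "g \<in> TS_star sym_gens" and e: "e \<in> comm_span"
      and eq: "sum ?h I1 + sum ?h I2 = g + e"
      unfolding free.span_Un free.span_eq_iff[THEN iffD2, OF subspace_TS]
        free.span_eq_iff[THEN iffD2, OF subspace_comm_span] by blast
    have "f - g = sum ?h I0 + e"
      by (simp add: split eq)
    moreover have "f - g \<in> star_central_polys ut2_scale s"
      using f g sub by (intro central_diff) auto
    ultimately have central: "sum ?h I0 + e \<in> star_central_polys ut2_scale s"
      by simp
    have "sum ?h I0 \<in> Y_span"
      by (intro free.subspace_sum[OF subspace_Y_span] free.subspace_scale[OF subspace_Y_span] Y_span_word)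
        (simp add: I0_def)
    \<comment> \<open>Once \<open>g\<close> is split off, the commutators in \<open>e\<close> form
      an identity; modulo \<open>T\<close> only the part \<open>h\<close> in symmetric generators
      remains.\<close>
    then obtain h where h: "h \<in> gy_span" "e - h \<in> T"
      using comm_span_central e central by (metis central_iff)
    have "(sum ?h I0 + e) - (e - h) \<in> star_central_polys ut2_scale s"
      by (rule central_diff[OF central T_ideal_central[OF h(2)]])
    then have "sum ?h I0 + h \<in> TS_star sym_gens"
      by (intro central_no_skew fin(1) h(1)) (simp_all add: I0_def)
    then have "(sum ?h I0 + h) + (e - h) + g \<in> TS_star sym_gens"
      by (rule TS_add[OF TS_add[OF _ T_ideal_subset[OF h(2)]] g])
    moreover have "(sum ?h I0 + h) + (e - h) + g = f"
      by (simp add: split eq)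
    ultimately show "f \<in> TS_star sym_gens"
      by simp
  qed
qed

end

section \<open>Finite generation for every involution of the first kind\<close>

theorem theorem1p5:
  fixes s :: "'a::field ut2 \<Rightarrow> 'a ut2"
  assumes "CHAR('a) \<noteq> 2"
    and "involution s"
    and "first_kind s"
  shows "\<exists>W :: 'a free_alg set. finite W \<and> star_central_polys ut2_scale s = TS_star W"
proof -
  have "\<not> CHAR('a) dvd 2"
  proof
    assume "CHAR('a) dvd 2"
    then have "CHAR('a) \<le> 2"
      by (rule dvd_imp_le) simp
    moreover have "CHAR('a) \<noteq> 0"
      using \<open>CHAR('a) dvd 2\<close> by (metis dvd_0_left zero_neq_numeral)
    moreover have "CHAR('a) \<noteq> 1"
      using CHAR_not_1'[where 'a = 'a] by simp
    ultimately show False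
      using assms(1) by linarith
  qed
  then have two: "(2::'a) \<noteq> 0"
    using of_nat_eq_0_iff_char_dvd[of 2, where 'a = 'a] by simp
  obtain \<epsilon> \<nu> where coords: "\<epsilon> = 1 \<or> \<epsilon> = -1" "\<And>x. e11 (s x) = e22 x" "\<And>x. e22 (s x) = e11 x"
    "\<And>x. k12 \<nu> (s x) = \<epsilon> * k12 \<nu> x"
    using ut2_involution_coords[OF two assms(2,3)] by blast
  interpret ut2_star s \<epsilon> \<nu> "field_exp TYPE('a)"
    by unfold_locales (rule two refl assms coords)+
  from coords(1) show ?thesis
  proof
    assume "\<epsilon> = 1"
    then interpret ut2_sym s \<epsilon> \<nu> "field_exp TYPE('a)"
      by unfold_locales
    show ?thesis
      using finite_sym_gens central_polys_eq by blast
  next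
    assume "\<epsilon> = -1"
    then interpret ut2_skew s \<epsilon> \<nu> "field_exp TYPE('a)"
      by unfold_locales
    show ?thesis
      using finite_skew_gens central_polys_eq by blast
  qed
qed

end
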